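(* A power series $f=\sum_{k\ge0}f_kz^k\in\mathbb H[[z]]$ is a Blaschke product of degree $n$ if and only if, for all $k\ge1$, the matrix ${\bf T}_k^f$ is contractive and $$\operatorname{rank}{\bf P}_k^f=\min(k,n),\qquad\text{where}\quad{\bf P}_k^f:=I_k-{\bf T}_k^f({\bf T}_k^f)^*.$$
   Context: $\mathbb H$ is the skew field of real quaternions with conjugation $\alpha\mapsto\overline\alpha$ and modulus $|\cdot|$; $\mathbb B_1=\{\alpha\in\mathbb H:|\alpha|<1\}$. $\mathbb H[[z]]$ is the ring of formal power series in a variable $z$ commuting with the quaternionic coefficients, with the Cauchy product $(fg)_k=\sum_{\ell=0}^kf_\ell g_{k-\ell}$. For $f=\sum_kf_kz^k$, ${\bf T}_k^f\in\mathbb H^{k\times k}$ is the lower triangular Toeplitz matrix with $(i,j)$ entry $f_{i-j}$ for $i\ge j$ and $0$ for $i<j$ (so $f_0$ is on the diagonal and the first column is $(f_0,f_1,\dots,f_{k-1})^\top$). ${}^*$ is the conjugate transpose. A matrix $T$ is contractive if $I-TT^*$ is positive semidefinite. For $\alpha\in\mathbb B_1$, the Blaschke factor is ${\bf b}_\alpha(z)=(z-\alpha)\sum_{k\ge0}\overline\alpha^kz^k$. A finite Blaschke product of degree $n\ge0$ is a power series ${\bf b}_{\alpha_1}\cdots{\bf b}_{\alpha_n}\phi$ with $\alpha_1,\dots,\alpha_n\in\mathbb B_1$ and $\phi\in\mathbb H$, $|\phi|=1$ (unimodular constants have degree $0$). *)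

theory Defs
  imports
    "HOL-Analysis.Inner_Product"
    "HOL-Computational_Algebra.Formal_Power_Series"
    "Jordan_Normal_Form.Matrix"
begin

section \<open>The skew field of real quaternions\<close>

text \<open>\<open>Quat a b c d\<close> is \<open>a + b i + c j + d k\<close>.\<close>

datatype quat = Quat (qRe: real) (qIm1: real) (qIm2: real) (qIm3: real)

lemma quat_eq_iff:
  "x = y \<longleftrightarrow> qRe x = qRe y \<and> qIm1 x = qIm1 y \<and> qIm2 x = qIm2 y \<and> qIm3 x = qIm3 y"
  by (cases x; cases y) simp

instantiation quat :: real_inner
begin

definition zero_quat_def: "0 = Quat 0 0 0 0"

definition plus_quat_def:
  "x + y = Quat (qRe x + qRe y) (qIm1 x + qIm1 y) (qIm2 x + qIm2 y) (qIm3 x + qIm3 y)"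

definition uminus_quat_def: "- x = Quat (- qRe x) (- qIm1 x) (- qIm2 x) (- qIm3 x)"

definition minus_quat_def:
  "x - y = Quat (qRe x - qRe y) (qIm1 x - qIm1 y) (qIm2 x - qIm2 y) (qIm3 x - qIm3 y)"

definition scaleR_quat_def:
  "r *\<^sub>R x = Quat (r * qRe x) (r * qIm1 x) (r * qIm2 x) (r * qIm3 x)"

definition inner_quat_def:
  "inner x y = qRe x * qRe y + qIm1 x * qIm1 y + qIm2 x * qIm2 y + qIm3 x * qIm3 y"

definition norm_quat_def:
  "norm x = sqrt ((qRe x)\<^sup>2 + (qIm1 x)\<^sup>2 + (qIm2 x)\<^sup>2 + (qIm3 x)\<^sup>2)"

definition sgn_quat_def: "sgn x = inverse (norm x) *\<^sub>R (x :: quat)"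

definition dist_quat_def: "dist x y = norm (x - y :: quat)"

definition [code del]:
  "(uniformity :: (quat \<times> quat) filter) = (INF e\<in>{0 <..}. principal {(x, y). dist x y < e})"

definition [code del]:
  "open (U :: quat set) \<longleftrightarrow> (\<forall>x\<in>U. eventually (\<lambda>(x', y). x' = x \<longrightarrow> y \<in> U) uniformity)"

instance
proof
  fix x y z :: quat and r s :: real and U :: "quat set"
  note defs = zero_quat_def plus_quat_def uminus_quat_def minus_quat_def scaleR_quat_def
    inner_quat_def quat_eq_iff
  show "x + y + z = x + (y + z)" "x + y = y + x" "0 + x = x" "- x + x = 0" "x - y = x + - y"
    by (simp_all add: defs)
  show "r *\<^sub>R (x + y) = r *\<^sub>R x + r *\<^sub>R y" "(r + s) *\<^sub>R x = r *\<^sub>R x + s *\<^sub>R x"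
    "r *\<^sub>R s *\<^sub>R x = (r * s) *\<^sub>R x" "1 *\<^sub>R x = x"
    by (simp_all add: defs algebra_simps)
  show "sgn x = inverse (norm x) *\<^sub>R x" "dist x y = norm (x - y)"
    by (simp_all add: sgn_quat_def dist_quat_def)
  show "(uniformity :: (quat \<times> quat) filter) = (INF e\<in>{0 <..}. principal {(x, y). dist x y < e})"
    by (rule uniformity_quat_def)
  show "open U \<longleftrightarrow> (\<forall>x\<in>U. eventually (\<lambda>(x', y). x' = x \<longrightarrow> y \<in> U) uniformity)"
    by (rule open_quat_def)
  show "inner x y = inner y x" "inner (x + y) z = inner x z + inner y z"
    "inner (r *\<^sub>R x) y = r * inner x y" "0 \<le> inner x x"
    by (simp_all add: defs algebra_simps)
  show "inner x x = 0 \<longleftrightarrow> x = 0"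
    by (auto simp: defs add_nonneg_eq_0_iff)
  show "norm x = sqrt (inner x x)"
    by (simp add: norm_quat_def inner_quat_def power2_eq_square)
qed

end

definition qcnj :: "quat \<Rightarrow> quat" where
  "qcnj x = Quat (qRe x) (- qIm1 x) (- qIm2 x) (- qIm3 x)"

instantiation quat :: real_normed_div_algebra
begin

definition one_quat_def: "1 = Quat 1 0 0 0"

definition times_quat_def:
  "x * y = Quat
     (qRe x * qRe y - qIm1 x * qIm1 y - qIm2 x * qIm2 y - qIm3 x * qIm3 y)
     (qRe x * qIm1 y + qIm1 x * qRe y + qIm2 x * qIm3 y - qIm3 x * qIm2 y)
     (qRe x * qIm2 y - qIm1 x * qIm3 y + qIm2 x * qRe y + qIm3 x * qIm1 y)
     (qRe x * qIm3 y + qIm1 x * qIm2 y - qIm2 x * qIm1 y + qIm3 x * qRe y)"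

definition inverse_quat_def: "inverse x = inverse ((norm x)\<^sup>2) *\<^sub>R qcnj x"

definition divide_quat_def: "x div y = x * inverse (y :: quat)"

instance
proof
  fix x y z :: quat and r :: real
  note defs = zero_quat_def one_quat_def plus_quat_def scaleR_quat_def times_quat_def quat_eq_iff
  have sq: "(norm u)\<^sup>2 = (qRe u)\<^sup>2 + (qIm1 u)\<^sup>2 + (qIm2 u)\<^sup>2 + (qIm3 u)\<^sup>2" for u :: quat
    by (simp add: norm_quat_def)
  show "x * y * z = x * (y * z)" "(x + y) * z = x * z + y * z" "x * (y + z) = x * y + x * z"
    "1 * x = x" "x * 1 = x" "(0 :: quat) \<noteq> 1"
    "r *\<^sub>R x * y = r *\<^sub>R (x * y)" "x * r *\<^sub>R y = r *\<^sub>R (x * y)"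
    by (simp_all add: defs algebra_simps)
  show "inverse (0 :: quat) = 0"
    by (simp add: inverse_quat_def)
  have "x * qcnj x = (norm x)\<^sup>2 *\<^sub>R 1" "qcnj x * x = (norm x)\<^sup>2 *\<^sub>R 1"
    unfolding sq by (simp_all add: defs qcnj_def algebra_simps power2_eq_square)
  moreover have "u * (r *\<^sub>R v) = r *\<^sub>R (u * v)" "(r *\<^sub>R u) * v = r *\<^sub>R (u * v)" for r and u v :: quat
    by (simp_all add: defs algebra_simps)
  ultimately show "inverse x * x = 1" "x * inverse x = 1" if "x \<noteq> 0"
    using that by (simp_all add: inverse_quat_def)
  show "x div y = x * inverse y"
    by (rule divide_quat_def)
  have "(norm (x * y))\<^sup>2 = (norm x * norm y)\<^sup>2"
    unfolding power_mult_distrib sq by (simp add: times_quat_def power2_eq_square algebra_simps)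
  then show "norm (x * y) = norm x * norm y"
    by (simp add: power2_eq_iff_nonneg)
qed

end

section \<open>Quaternionic matrices\<close>

definition qadjoint :: "quat mat \<Rightarrow> quat mat" where
  "qadjoint A = mat (dim_col A) (dim_row A) (\<lambda>(i, j). qcnj (A $$ (j, i)))"

definition qpos_semidef :: "quat mat \<Rightarrow> bool" where
  "qpos_semidef A \<longleftrightarrow>
     square_mat A \<and> qadjoint A = A \<and>
     (\<forall>x \<in> carrier_vec (dim_row A).
        \<exists>r \<ge> 0. scalar_prod (map_vec qcnj x) (A *\<^sub>v x) = of_real r)"

definition qcontractive :: "quat mat \<Rightarrow> bool" where
  "qcontractive T \<longleftrightarrow> qpos_semidef (1\<^sub>m (dim_row T) - T * qadjoint T)"

text \<open>
  The library's notions of linear independence and rank require commutative scalars, so they do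
  not apply over the quaternions. Scalars act on columns from the right. The columns are treated
  as a family indexed by \<open>J\<close>, so a repeated column makes the family dependent.
\<close>

definition right_indep_cols :: "quat mat \<Rightarrow> nat set \<Rightarrow> bool" where
  "right_indep_cols A J \<longleftrightarrow>
     (\<forall>c :: nat \<Rightarrow> quat.
        (\<forall>i < dim_row A. (\<Sum>j\<in>J. A $$ (i, j) * c j) = 0) \<longrightarrow> (\<forall>j\<in>J. c j = 0))"

definition qrank :: "quat mat \<Rightarrow> nat" where
  "qrank A = Max {card J | J. J \<subseteq> {..<dim_col A} \<and> right_indep_cols A J}"

section \<open>Toeplitz matrices and Blaschke products\<close>

definition toeplitz :: "nat \<Rightarrow> quat fps \<Rightarrow> quat mat" where
  "toeplitz k f = mat k k (\<lambda>(i, j). if j \<le> i then fps_nth f (i - j) else 0)"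

definition pick_matrix :: "nat \<Rightarrow> quat fps \<Rightarrow> quat mat" where
  "pick_matrix k f = 1\<^sub>m k - toeplitz k f * qadjoint (toeplitz k f)"

definition blaschke_factor :: "quat \<Rightarrow> quat fps" where
  "blaschke_factor \<alpha> = (fps_X - fps_const \<alpha>) * Abs_fps (\<lambda>k. qcnj \<alpha> ^ k)"

definition is_blaschke_product :: "nat \<Rightarrow> quat fps \<Rightarrow> bool" where
  "is_blaschke_product n f \<longleftrightarrow>
     (\<exists>\<alpha>s \<phi>. length \<alpha>s = n \<and> (\<forall>\<alpha> \<in> set \<alpha>s. norm \<alpha> < 1) \<and> norm \<phi> = 1 \<and>
        f = prod_list (map blaschke_factor \<alpha>s) * fps_const \<phi>)"

end

theory Submission
  imports Defs "HOL-Computational_Algebra.Fundamental_Theorem_Algebra"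
begin

text \<open>
  Let \<open>T\<close> be the Toeplitz matrix of order \<open>k\<close> of \<open>f\<close>. It is a contraction iff the Toeplitz matrix of
  the series \<open>f\<^sup>#\<close> with conjugated coefficients is, and the kernel of \<open>I - T T\<^sup>*\<close> consists, after
  reversal, of the polynomials \<open>p\<close> of degree less than \<open>k\<close> with \<open>\<parallel>f\<^sup># p\<parallel> = \<parallel>p\<parallel>\<close>; then \<open>f\<^sup># p\<close> is itself a
  polynomial of degree less than \<open>k\<close>, and \<open>f\<close> has a kernel of the same kind.

  Suppose that \<open>f\<close> is contractive and that \<open>m + 1\<close> is the smallest order with a nonzero isometric
  polynomial \<open>p\<close>. Minimality forces \<open>p\<close> to have no zeros in the closed unit disc, and (applied to \<open>f\<^sup>#\<close>)
  it forces \<open>f p\<close> to have degree \<open>m\<close> and all its zeros in the open disc. For \<open>m > 0\<close> and a left zero \<open>\<alpha>\<close>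
  of \<open>f p\<close> it follows that \<open>\<alpha>\<close> is a left zero of \<open>f\<close>, so that \<open>f = b\<^sub>\<alpha> g\<close>; the quotient \<open>g\<close> is again
  contractive and has an isometric polynomial of degree less than \<open>m\<close>. By induction \<open>f\<close> is a
  Blaschke product as soon as one Pick matrix is singular.

  Conversely, for a Blaschke product of degree \<open>n\<close> the equation \<open>\<parallel>f\<^sup># p\<parallel> = \<parallel>p\<parallel>\<close> amounts to \<open>n\<close> linear
  conditions on \<open>p\<close>, and the absence of zeros just described shows by induction on \<open>n\<close> that no nonzero
  polynomial of degree less than \<open>n\<close> satisfies it. This gives the rank, which determines the degree.
\<close>

no_notation vec_index (infixl "$" 100)
unbundle fps_syntax

section \<open>Quaternions\<close>

lemma qcnj_simps [simp]:
  "qRe (qcnj x) = qRe x" "qIm1 (qcnj x) = - qIm1 x" "qIm2 (qcnj x) = - qIm2 x"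
  "qIm3 (qcnj x) = - qIm3 x"
  by (simp_all add: qcnj_def)

lemma quat_component_simps [simp]:
  "qRe 0 = 0" "qIm1 0 = 0" "qIm2 0 = 0" "qIm3 0 = 0"
  "qRe 1 = 1" "qIm1 1 = 0" "qIm2 1 = 0" "qIm3 1 = 0"
  "qRe (x + y) = qRe x + qRe y" "qIm1 (x + y) = qIm1 x + qIm1 y"
  "qIm2 (x + y) = qIm2 x + qIm2 y" "qIm3 (x + y) = qIm3 x + qIm3 y"
  "qRe (x - y) = qRe x - qRe y" "qIm1 (x - y) = qIm1 x - qIm1 y"
  "qIm2 (x - y) = qIm2 x - qIm2 y" "qIm3 (x - y) = qIm3 x - qIm3 y"
  "qRe (- x) = - qRe x" "qIm1 (- x) = - qIm1 x"
  "qIm2 (- x) = - qIm2 x" "qIm3 (- x) = - qIm3 x"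
  "qRe (r *\<^sub>R x) = r * qRe x" "qIm1 (r *\<^sub>R x) = r * qIm1 x"
  "qIm2 (r *\<^sub>R x) = r * qIm2 x" "qIm3 (r *\<^sub>R x) = r * qIm3 x"
  by (simp_all add: zero_quat_def one_quat_def plus_quat_def minus_quat_def uminus_quat_def
      scaleR_quat_def)

lemma quat_times_simps:
  "qRe (x * y) = qRe x * qRe y - qIm1 x * qIm1 y - qIm2 x * qIm2 y - qIm3 x * qIm3 y"
  "qIm1 (x * y) = qRe x * qIm1 y + qIm1 x * qRe y + qIm2 x * qIm3 y - qIm3 x * qIm2 y"
  "qIm2 (x * y) = qRe x * qIm2 y - qIm1 x * qIm3 y + qIm2 x * qRe y + qIm3 x * qIm1 y"
  "qIm3 (x * y) = qRe x * qIm3 y + qIm1 x * qIm2 y - qIm2 x * qIm1 y + qIm3 x * qRe y"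
  by (simp_all add: times_quat_def)

lemma qRe_of_real [simp]: "qRe (of_real r) = r"
  by (simp add: of_real_def)

lemma qcnj_qcnj [simp]: "qcnj (qcnj x) = x"
  by (simp add: quat_eq_iff)

lemma qcnj_0 [simp]: "qcnj 0 = 0"
  by (simp add: quat_eq_iff)

lemma qcnj_1 [simp]: "qcnj 1 = 1"
  by (simp add: quat_eq_iff)

lemma qcnj_add [simp]: "qcnj (x + y) = qcnj x + qcnj y"
  by (simp add: quat_eq_iff)

lemma qcnj_diff [simp]: "qcnj (x - y) = qcnj x - qcnj y"
  by (simp add: quat_eq_iff)

lemma qcnj_minus: "qcnj (- x) = - qcnj x"
  by (simp add: quat_eq_iff)

lemma qcnj_mult [simp]: "qcnj (x * y) = qcnj y * qcnj x"
  by (simp add: quat_eq_iff quat_times_simps algebra_simps)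

lemma qcnj_power [simp]: "qcnj (x ^ n) = qcnj x ^ n"
  by (induction n) (simp_all add: power_commutes)

lemma qcnj_sum [simp]: "qcnj (sum f A) = (\<Sum>i\<in>A. qcnj (f i))"
  by (induction A rule: infinite_finite_induct) simp_all

lemma norm_qcnj [simp]: "norm (qcnj x) = norm x"
  by (simp add: norm_quat_def)

lemma qcnj_eq_0_iff [simp]: "qcnj x = 0 \<longleftrightarrow> x = 0"
  by (simp add: quat_eq_iff)

lemma norm_quat_sq: "(norm x)\<^sup>2 = (qRe x)\<^sup>2 + (qIm1 x)\<^sup>2 + (qIm2 x)\<^sup>2 + (qIm3 x)\<^sup>2"
  by (simp add: norm_quat_def)

lemma qcnj_mult_self: "qcnj x * x = of_real ((norm x)\<^sup>2)"
  unfolding norm_quat_sq by (simp add: of_real_def quat_eq_iff quat_times_simps power2_eq_square)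

lemma qRe_qcnj_mult: "qRe (qcnj x * y) = inner x y"
  by (simp add: inner_quat_def quat_times_simps)

section \<open>Truncated norms and contractive power series\<close>

definition fps_qcnj :: "quat fps \<Rightarrow> quat fps" where
  "fps_qcnj f = Abs_fps (\<lambda>k. qcnj (f $ k))"

lemma fps_qcnj_nth [simp]: "fps_qcnj f $ k = qcnj (f $ k)"
  by (simp add: fps_qcnj_def)

lemma fps_qcnj_fps_qcnj [simp]: "fps_qcnj (fps_qcnj f) = f"
  by (simp add: fps_eq_iff)

lemma fps_qcnj_mult: "fps_qcnj (f * g) = fps_qcnj g * fps_qcnj f"
proof (rule fps_ext)
  fix n
  have "fps_qcnj (f * g) $ n = (\<Sum>i=0..n. qcnj (g $ (n - i)) * qcnj (f $ i))"
    by (simp add: fps_mult_nth)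
  also have "\<dots> = (\<Sum>i=0..n. qcnj (g $ i) * qcnj (f $ (n - i)))"
    by (subst sum.atLeastAtMost_rev) (auto intro!: sum.cong)
  finally show "fps_qcnj (f * g) $ n = (fps_qcnj g * fps_qcnj f) $ n"
    by (simp add: fps_mult_nth)
qed

lemma fps_qcnj_const [simp]: "fps_qcnj (fps_const c) = fps_const (qcnj c)"
  by (simp add: fps_eq_iff)

text \<open>Reversal of the polynomial formed by the first \<open>k\<close> coefficients; it turns the adjoint of the
  Toeplitz matrix of \<open>f\<close> into the Toeplitz matrix of \<open>fps_qcnj f\<close>.\<close>

definition fps_flip :: "nat \<Rightarrow> 'a::zero fps \<Rightarrow> 'a fps" where
  "fps_flip k p = Abs_fps (\<lambda>i. if i < k then p $ (k - Suc i) else 0)"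

lemma fps_flip_nth [simp]: "fps_flip k p $ i = (if i < k then p $ (k - Suc i) else 0)"
  by (simp add: fps_flip_def)

lemma fps_flip_flip [simp]: "fps_flip k (fps_flip k p) = fps_cutoff k p"
  by (auto simp: fps_eq_iff)

definition deg_lt :: "nat \<Rightarrow> 'a::zero fps \<Rightarrow> bool" where
  "deg_lt k p \<longleftrightarrow> (\<forall>i\<ge>k. p $ i = 0)"

lemma deg_lt_0_iff: "deg_lt 0 p \<longleftrightarrow> p = 0"
  by (auto simp: deg_lt_def fps_eq_iff)

lemma deg_lt_mono: "deg_lt k p \<Longrightarrow> k \<le> l \<Longrightarrow> deg_lt l p"
  by (auto simp: deg_lt_def)

lemma deg_lt_flip [simp]: "deg_lt k (fps_flip k p)"
  by (simp add: deg_lt_def)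

lemma deg_lt_cutoff_eq: "deg_lt k p \<Longrightarrow> fps_cutoff k p = p"
  by (auto simp: deg_lt_def fps_eq_iff)

definition sqsum :: "nat \<Rightarrow> quat fps \<Rightarrow> real" where
  "sqsum k p = (\<Sum>i<k. (norm (p $ i))\<^sup>2)"

definition qdot :: "nat \<Rightarrow> quat fps \<Rightarrow> quat fps \<Rightarrow> quat" where
  "qdot k p q = (\<Sum>i<k. qcnj (p $ i) * q $ i)"

lemma sqsum_cong: "(\<And>i. i < k \<Longrightarrow> p $ i = q $ i) \<Longrightarrow> sqsum k p = sqsum k q"
  by (simp add: sqsum_def)

lemma sqsum_nonneg [simp]: "0 \<le> sqsum k p"
  by (simp add: sqsum_def sum_nonneg)

lemma sqsum_mono: "k \<le> l \<Longrightarrow> sqsum k p \<le> sqsum l p"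
  unfolding sqsum_def by (rule sum_mono2) auto

lemma norm_nth_le_sqsum: "i < k \<Longrightarrow> (norm (p $ i))\<^sup>2 \<le> sqsum k p"
  unfolding sqsum_def by (rule member_le_sum) auto

lemma sqsum_eq_0_iff: "sqsum k p = 0 \<longleftrightarrow> (\<forall>i<k. p $ i = 0)"
  by (auto simp: sqsum_def sum_nonneg_eq_0_iff)

lemma sqsum_cutoff [simp]: "sqsum k (fps_cutoff k p) = sqsum k p"
  by (rule sqsum_cong) simp

lemma sqsum_flip [simp]: "sqsum k (fps_flip k p) = sqsum k p"
  using sum.nat_diff_reindex[of "\<lambda>i. (norm (p $ i))\<^sup>2" k] by (simp add: sqsum_def)

lemma sqsum_deg_lt: "deg_lt k p \<Longrightarrow> k \<le> l \<Longrightarrow> sqsum l p = sqsum k p"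
  unfolding sqsum_def by (rule sum.mono_neutral_right) (auto simp: deg_lt_def)

lemma deg_lt_if_sqsum:
  assumes "\<And>l. k \<le> l \<Longrightarrow> sqsum l p \<le> sqsum k p"
  shows "deg_lt k p"
  unfolding deg_lt_def
proof (intro allI impI)
  fix i assume "k \<le> i"
  have "sqsum k p + (norm (p $ i))\<^sup>2 \<le> sqsum (Suc i) p"
    using sqsum_mono[OF \<open>k \<le> i\<close>, of p] by (simp add: sqsum_def)
  also have "\<dots> \<le> sqsum k p"
    using assms \<open>k \<le> i\<close> by simp
  finally show "p $ i = 0"
    by simp
qed

lemma sqsum_X_mult: "sqsum (Suc k) (fps_X * p) = sqsum k p"
  unfolding sqsum_def sum.lessThan_Suc_shift by simp

lemma sqsum_X_power_mult: "sqsum (d + k) (fps_X ^ d * p) = sqsum k p"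
  by (induction d) (simp_all add: sqsum_X_mult mult.assoc)

lemma sqsum_mult_const: "sqsum k (p * fps_const c) = (norm c)\<^sup>2 * sqsum k p"
  by (simp add: sqsum_def norm_mult power_mult_distrib sum_distrib_left mult.commute)

lemma sqsum_const_mult: "sqsum k (fps_const c * p) = (norm c)\<^sup>2 * sqsum k p"
  by (simp add: sqsum_def norm_mult power_mult_distrib sum_distrib_left)

lemma qdot_self: "qdot k p p = of_real (sqsum k p)"
  by (simp add: qdot_def sqsum_def qcnj_mult_self)

lemma qRe_sum [simp]: "qRe (sum g A) = (\<Sum>i\<in>A. qRe (g i))"
  by (induction A rule: infinite_finite_induct) simp_all

lemma qRe_qdot: "qRe (qdot k p q) = (\<Sum>i<k. inner (p $ i) (q $ i))"
  by (simp add: qdot_def qRe_qcnj_mult)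

lemma sqsum_diff: "sqsum k (p - q) = sqsum k p - 2 * qRe (qdot k p q) + sqsum k q"
  unfolding qRe_qdot sqsum_def
  by (simp add: power2_norm_eq_inner inner_diff_left inner_diff_right
      inner_commute sum.distrib sum_subtractf sum_distrib_left algebra_simps)

lemma sqsum_parallelogram: "sqsum k (p + q) + sqsum k (p - q) = 2 * sqsum k p + 2 * sqsum k q"
  unfolding sqsum_def
  by (simp add: power2_norm_eq_inner inner_diff_left inner_diff_right inner_add_left inner_add_right
      sum.distrib sum_subtractf sum_distrib_left)

lemma fps_mult_nth_toeplitz:
  fixes f p :: "'a::semiring_0 fps"
  assumes "i < k"
  shows "(f * p) $ i = (\<Sum>l<k. (if l \<le> i then f $ (i - l) else 0) * p $ l)"
proof -
  have "(f * p) $ i = (\<Sum>l=0..i. f $ (i - l) * p $ l)"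
    unfolding fps_mult_nth by (subst sum.atLeastAtMost_rev) (auto intro!: sum.cong)
  also have "\<dots> = (\<Sum>l<k. (if l \<le> i then f $ (i - l) else 0) * p $ l)"
    using assms by (intro sum.mono_neutral_cong_left) auto
  finally show ?thesis .
qed

lemma fps_mult_nth_cong:
  assumes "\<And>j. j \<le> i \<Longrightarrow> p $ j = q $ j"
  shows "(f * p) $ i = (f * q) $ i"
  using assms by (simp add: fps_mult_nth)

lemma sqsum_mult_cong: "(\<And>i. i < k \<Longrightarrow> p $ i = q $ i) \<Longrightarrow> sqsum k (f * p) = sqsum k (f * q)"
  by (rule sqsum_cong, rule fps_mult_nth_cong) simp

text \<open>A Toeplitz matrix is symmetric about its antidiagonal, so multiplication by
  \<open>h\<close> between two reversals acts as the transposed Toeplitz matrix.\<close>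

lemma fps_flip_mult_flip_nth:
  fixes h p :: "'a::semiring_0 fps"
  assumes "l < k"
  shows "fps_flip k (h * fps_flip k p) $ l = (\<Sum>i<k. (if l \<le> i then h $ (i - l) else 0) * p $ i)"
proof -
  have "fps_flip k (h * fps_flip k p) $ l
      = (\<Sum>j<k. (if j \<le> k - Suc l then h $ (k - Suc l - j) else 0) * p $ (k - Suc j))"
    using assms by (simp add: fps_mult_nth_toeplitz[of "k - Suc l" k])
  also have "\<dots> = (\<Sum>j<k. (if l \<le> k - Suc j then h $ (k - Suc j - l) else 0) * p $ (k - Suc j))"
  proof (rule sum.cong[OF refl])
    fix j assume "j \<in> {..<k}"
    then have "j \<le> k - Suc l \<longleftrightarrow> l \<le> k - Suc j" "k - Suc l - j = k - Suc j - l"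
      using assms by auto
    then show "(if j \<le> k - Suc l then h $ (k - Suc l - j) else 0) * p $ (k - Suc j)
      = (if l \<le> k - Suc j then h $ (k - Suc j - l) else 0) * p $ (k - Suc j)"
      by simp
  qed
  also have "\<dots> = (\<Sum>i<k. (if l \<le> i then h $ (i - l) else 0) * p $ i)"
    by (rule sum.nat_diff_reindex)
  finally show ?thesis .
qed

text \<open>The adjoint of the Toeplitz matrix of \<open>f\<close> is the transpose of that of
  \<open>fps_qcnj f\<close>, that is, multiplication by \<open>fps_qcnj f\<close> between two
  reversals.\<close>

lemma qdot_mult_right:
  "qdot k p (f * q) = qdot k (fps_flip k (fps_qcnj f * fps_flip k p)) q"
proof -
  have "qdot k p (f * q)
      = (\<Sum>i<k. \<Sum>l<k. qcnj (p $ i) * (if l \<le> i then f $ (i - l) else 0) * q $ l)"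
    by (simp add: qdot_def fps_mult_nth_toeplitz[of _ k] sum_distrib_left mult.assoc)
  also have "\<dots> = (\<Sum>l<k. \<Sum>i<k. qcnj (p $ i) * (if l \<le> i then f $ (i - l) else 0) * q $ l)"
    by (rule sum.swap)
  also have "\<dots> = qdot k (fps_flip k (fps_qcnj f * fps_flip k p)) q"
    unfolding qdot_def
    by (intro sum.cong refl, subst fps_flip_mult_flip_nth)
       (auto simp: sum_distrib_right intro!: sum.cong)
  finally show ?thesis .
qed

section \<open>Contractive series and polynomials of preserved norm\<close>

definition contractive_fps :: "quat fps \<Rightarrow> bool" where
  "contractive_fps f \<longleftrightarrow> (\<forall>k p. sqsum k (f * p) \<le> sqsum k p)"

lemma contractive_fpsD: "contractive_fps f \<Longrightarrow> sqsum k (f * p) \<le> sqsum k p"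
  by (simp add: contractive_fps_def)

lemma contractive_fps_mult:
  "contractive_fps f \<Longrightarrow> contractive_fps g \<Longrightarrow> contractive_fps (f * g)"
  unfolding contractive_fps_def mult.assoc by (meson order_trans)

text \<open>This passes from I - T* T, which \<open>contractive_fps\<close> controls, to I - T T*,
  the Pick matrix. With y = T* x, the identity |y|^2 = Re <x, T y> and 0 <= |x - T y|^2 give 2 |y|^2
  <= |x|^2 + |T y|^2 <= |x|^2 + |y|^2.\<close>

lemma contractive_fps_qcnj:
  assumes "contractive_fps f"
  shows "contractive_fps (fps_qcnj f)"
  unfolding contractive_fps_def
proof (intro allI)
  fix k p
  define y where "y = fps_flip k (fps_qcnj f * p)"
  define x where "x = fps_flip k p"
  have y: "y = fps_flip k (fps_qcnj f * fps_flip k x)"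
    unfolding y_def x_def fps_eq_iff
    by (auto intro!: fps_mult_nth_cong)
  have "sqsum k y = qRe (qdot k x (f * y))"
    unfolding qdot_mult_right y[symmetric] by (simp add: qdot_self)
  moreover have "0 \<le> sqsum k (x - f * y)"
    by simp
  ultimately have "2 * sqsum k y \<le> sqsum k x + sqsum k (f * y)"
    unfolding sqsum_diff by simp
  also have "\<dots> \<le> sqsum k x + sqsum k y"
    using contractive_fpsD[OF assms] by simp
  finally show "sqsum k (fps_qcnj f * p) \<le> sqsum k p"
    by (simp add: x_def y_def)
qed

lemma contractive_fps_qcnj_iff [simp]: "contractive_fps (fps_qcnj f) \<longleftrightarrow> contractive_fps f"
  using contractive_fps_qcnj[of f] contractive_fps_qcnj[of "fps_qcnj f"] by auto

text \<open>For a contraction \<open>T\<close>, \<open>\<parallel>T p\<parallel> = \<parallel>p\<parallel>\<close> forces \<open>T\<^sup>* T p = p\<close>.\<close>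

lemma isometric_adjoint_nth:
  assumes "contractive_fps f" and "sqsum k (f * p) = sqsum k p" and "i < k"
  shows "(fps_qcnj f * fps_flip k (f * p)) $ i = fps_flip k p $ i"
proof -
  define r where "r = fps_flip k (fps_qcnj f * fps_flip k (f * p))"
  have "sqsum k (r - p) = sqsum k r - 2 * qRe (qdot k (f * p) (f * p)) + sqsum k p"
    unfolding sqsum_diff r_def qdot_mult_right[symmetric] ..
  also have "\<dots> \<le> 0"
    using contractive_fpsD[OF contractive_fps_qcnj[OF assms(1)], of k "fps_flip k (f * p)"] assms(2)
    by (simp add: r_def qdot_self)
  finally have "sqsum k (r - p) = 0"
    using sqsum_nonneg[of k "r - p"] by linarith
  then have "r $ (k - Suc i) = p $ (k - Suc i)"
    using \<open>i < k\<close> by (simp add: sqsum_eq_0_iff)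
  moreover have "k - Suc (k - Suc i) = i"
    using \<open>i < k\<close> by simp
  ultimately show ?thesis
    using \<open>i < k\<close> by (simp add: r_def)
qed

definition isometric_poly :: "nat \<Rightarrow> quat fps \<Rightarrow> quat fps \<Rightarrow> bool" where
  "isometric_poly k f p \<longleftrightarrow> deg_lt k p \<and> sqsum k (f * p) = sqsum k p"

text \<open>Contractivity holds at every order: past \<open>k\<close> the norm of \<open>p\<close>
  no longer grows, and that of \<open>f * p\<close> has already reached it, so \<open>f * p\<close>
  has no further nonzero coefficient.\<close>

lemma isometric_poly_deg_lt_mult:
  assumes "contractive_fps f" and "isometric_poly k f p"
  shows "deg_lt k (f * p)"
proof (rule deg_lt_if_sqsum)
  fix l assume "k \<le> l"
  show "sqsum l (f * p) \<le> sqsum k (f * p)"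
    using contractive_fpsD[OF assms(1), of l p] assms(2) sqsum_deg_lt[of k p l] \<open>k \<le> l\<close>
    by (simp add: isometric_poly_def)
qed

lemma isometric_poly_mono:
  assumes "contractive_fps f" and "isometric_poly k f p" and "k \<le> l"
  shows "isometric_poly l f p"
  using assms isometric_poly_deg_lt_mult[OF assms(1,2)]
  by (auto simp: isometric_poly_def sqsum_deg_lt[of k _ l] intro: deg_lt_mono)

text \<open>The relation T* T p = p gives the first equation below \<open>k\<close>. Hence the
  flipped image is isometric for \<open>fps_qcnj f\<close>, and
  \<open>isometric_poly_deg_lt_mult\<close> kills the remaining coefficients.\<close>

lemma isometric_poly_flip:
  assumes "contractive_fps f" and "isometric_poly k f p"
  shows "fps_qcnj f * fps_flip k (f * p) = fps_flip k p"
    and "isometric_poly k (fps_qcnj f) (fps_flip k (f * p))"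
proof -
  have eq: "(fps_qcnj f * fps_flip k (f * p)) $ i = fps_flip k p $ i" if "i < k" for i
    using isometric_adjoint_nth[OF assms(1) _ that] assms(2) by (simp add: isometric_poly_def)
  then have "sqsum k (fps_qcnj f * fps_flip k (f * p)) = sqsum k (fps_flip k p)"
    by (rule sqsum_cong)
  then show iso: "isometric_poly k (fps_qcnj f) (fps_flip k (f * p))"
    using assms(2) by (simp add: isometric_poly_def)
  show "fps_qcnj f * fps_flip k (f * p) = fps_flip k p"
  proof (rule fps_ext)
    fix i
    show "(fps_qcnj f * fps_flip k (f * p)) $ i = fps_flip k p $ i"
    proof (cases "i < k")
      case False
      then show ?thesis
        using isometric_poly_deg_lt_mult[OF contractive_fps_qcnj[OF assms(1)] iso]
        by (simp add: deg_lt_def)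
    qed (rule eq)
  qed
qed

lemma fps_flip_eq_0_iff: "deg_lt k p \<Longrightarrow> fps_flip k p = 0 \<longleftrightarrow> p = 0"
  by (metis deg_lt_cutoff_eq fps_cutoff_zero fps_flip_flip fps_zero_nth fps_ext fps_flip_nth)

definition has_isometric :: "nat \<Rightarrow> quat fps \<Rightarrow> bool" where
  "has_isometric k f \<longleftrightarrow> (\<exists>p. p \<noteq> 0 \<and> isometric_poly k f p)"

lemma has_isometric_qcnj:
  assumes "contractive_fps f" and "has_isometric k f"
  shows "has_isometric k (fps_qcnj f)"
proof -
  obtain p where p: "p \<noteq> 0" "isometric_poly k f p"
    using assms(2) by (auto simp: has_isometric_def)
  have "fps_flip k p \<noteq> 0"
    using p by (simp add: fps_flip_eq_0_iff isometric_poly_def)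
  then have "fps_flip k (f * p) \<noteq> 0"
    using isometric_poly_flip(1)[OF assms(1) p(2)] by auto
  then show ?thesis
    using isometric_poly_flip(2)[OF assms(1) p(2)] by (auto simp: has_isometric_def)
qed

lemma has_isometric_qcnj_iff:
  "contractive_fps f \<Longrightarrow> has_isometric k (fps_qcnj f) \<longleftrightarrow> has_isometric k f"
  using has_isometric_qcnj[of f k] has_isometric_qcnj[of "fps_qcnj f" k] by auto

section \<open>Zeros of isometric polynomials\<close>

lemma fps_linear_mult_nth:
  "((fps_X - fps_const a) * p) $ i = (if i = 0 then 0 else p $ (i - 1)) - a * p $ i"
  for a :: "'a::ring_1"
  by (simp add: left_diff_distrib)

lemma fps_mult_linear_nth:
  "(p * (fps_X - fps_const a)) $ i = (if i = 0 then 0 else p $ (i - 1)) - p $ i * a"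
  for a :: "'a::ring_1"
  by (simp add: right_diff_distrib)

lemma fps_linear_neq_0 [simp]: "fps_X - fps_const a \<noteq> 0"
  for a :: "'a::ring_1"
proof
  assume "fps_X - fps_const a = 0"
  then have "(fps_X - fps_const a) $ 1 = 0"
    by simp
  then show False
    by simp
qed

text \<open>No order is fixed, so that the class is closed under multiplication by
  \<open>fps_X\<close>, which raises the order by one.\<close>

definition eventually_isometric :: "quat fps \<Rightarrow> quat fps \<Rightarrow> bool" where
  "eventually_isometric f p \<longleftrightarrow> (\<exists>N. \<forall>k\<ge>N. sqsum k (f * p) = sqsum k p)"

text \<open>The defect form \<open>\<parallel>p\<parallel>\<^sup>2 - \<parallel>f p\<parallel>\<^sup>2\<close> is positive semidefinite, so by the parallelogram law its
  null vectors are closed under addition.\<close>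

lemma eventually_isometric_add:
  assumes "contractive_fps f" "eventually_isometric f p" "eventually_isometric f q"
  shows "eventually_isometric f (p + q)"
proof -
  obtain M N where M: "\<And>k. k \<ge> M \<Longrightarrow> sqsum k (f * p) = sqsum k p"
    and N: "\<And>k. k \<ge> N \<Longrightarrow> sqsum k (f * q) = sqsum k q"
    using assms(2,3) unfolding eventually_isometric_def by blast
  have "sqsum k (f * (p + q)) = sqsum k (p + q)" if "k \<ge> max M N" for k
  proof -
    have "sqsum k (f * (p + q)) + sqsum k (f * (p - q)) = sqsum k (p + q) + sqsum k (p - q)"
      using M[of k] N[of k] that by (simp add: sqsum_parallelogram distrib_left right_diff_distrib)
    then show ?thesis
      using contractive_fpsD[OF assms(1), of k "p + q"] contractive_fpsD[OF assms(1), of k "p - q"]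
      by simp
  qed
  then show ?thesis
    unfolding eventually_isometric_def by blast
qed

lemma eventually_isometric_mult_const:
  "eventually_isometric f p \<Longrightarrow> eventually_isometric f (p * fps_const c)"
  unfolding eventually_isometric_def mult.assoc[symmetric] sqsum_mult_const by auto

lemma eventually_isometric_X_mult:
  assumes "eventually_isometric f p"
  shows "eventually_isometric f (fps_X * p)"
proof -
  obtain N where N: "\<And>k. k \<ge> N \<Longrightarrow> sqsum k (f * p) = sqsum k p"
    using assms unfolding eventually_isometric_def by blast
  have "sqsum k (f * (fps_X * p)) = sqsum k (fps_X * p)" if k: "k \<ge> Suc N" for k
  proof -
    have "f * (fps_X * p) = fps_X * (f * p)"
      by (metis fps_mult_fps_X_commute mult.assoc)
    moreover have "k = Suc (k - 1)"
      using k by simp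
    ultimately show ?thesis
      using N[of "k - 1"] k by (metis sqsum_X_mult Suc_le_mono)
  qed
  then show ?thesis
    unfolding eventually_isometric_def by blast
qed

lemma isometric_poly_eventually:
  "contractive_fps f \<Longrightarrow> isometric_poly k f p \<Longrightarrow> eventually_isometric f p"
  unfolding eventually_isometric_def using isometric_poly_mono[of f k p]
  by (auto simp: isometric_poly_def)

text \<open>The two terms have disjoint supports, one below \<open>m\<close> and the other from
  \<open>m\<close> on, so Pythagoras applies.\<close>

lemma sqsum_shift_diff:
  assumes "deg_lt m p" and "2 * m \<le> k"
  shows "sqsum k (fps_X ^ m * p - p * fps_const c) = (1 + (norm c)\<^sup>2) * sqsum m p"
proof -
  have "qdot k (fps_X ^ m * p) (p * fps_const c) = 0"
    unfolding qdot_def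
    by (rule sum.neutral) (use assms in \<open>auto simp: fps_X_power_mult_nth deg_lt_def not_less\<close>)
  moreover have "sqsum k (fps_X ^ m * p) = sqsum m p"
    using sqsum_X_power_mult[of m "k - m" p] assms sqsum_deg_lt[of m p "k - m"] by simp
  ultimately show ?thesis
    using assms sqsum_deg_lt[of m p k]
    by (simp add: sqsum_diff sqsum_mult_const algebra_simps)
qed

text \<open>A right zero in the closed disc can be cancelled, and the order drops by one. The degree
  of \<open>f * p\<close> is bounded first; then multiplication by z is compared with the scalar
  \<open>b\<close>.\<close>

lemma isometric_poly_right_factor:
  assumes f: "contractive_fps f" and iso: "isometric_poly (Suc m) f (p * (fps_X - fps_const b))"
    and p: "deg_lt m p" and b: "norm b \<le> 1"
  shows "isometric_poly m f p"
proof -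
  define s where "s = f * p"
  define t where "t = p * (fps_X - fps_const b)"
  have ft: "f * t = s * (fps_X - fps_const b)"
    by (simp add: s_def t_def mult.assoc)
  have "deg_lt (Suc m) (f * t)"
    using isometric_poly_deg_lt_mult[OF f iso] by (simp add: t_def)
  then have step: "s $ i = s $ Suc i * b" if "i \<ge> m" for i
    using that unfolding deg_lt_def ft fps_mult_linear_nth
    by (metis Suc_le_mono diff_Suc_1 nat.distinct(1) right_minus_eq)
  have grow: "norm (s $ i) \<le> norm (s $ (i + j))" if "i \<ge> m" for i j
  proof (induction j)
    case (Suc j)
    have "norm (s $ (i + j)) = norm (s $ (i + Suc j)) * norm b"
      using step[of "i + j"] that by (simp add: norm_mult)
    also have "\<dots> \<le> norm (s $ (i + Suc j)) * 1"
      by (rule mult_left_mono[OF b]) simp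
    finally show ?case
      using Suc by simp
  qed simp
  \<comment> \<open>From index \<open>m\<close> on the moduli of \<open>s\<close> do not decrease,
    yet the sum of their squares is at most \<open>sqsum m p\<close>; so they vanish.\<close>
  have s: "deg_lt m s"
    unfolding deg_lt_def
  proof (intro allI impI)
    fix i assume i: "m \<le> i"
    have bound: "real N * (norm (s $ i))\<^sup>2 \<le> sqsum m p" for N
    proof -
      have "real N * (norm (s $ i))\<^sup>2 \<le> (\<Sum>j<N. (norm (s $ (i + j)))\<^sup>2)"
        using sum_bounded_below[of "{..<N}" "(norm (s $ i))\<^sup>2" "\<lambda>j. (norm (s $ (i + j)))\<^sup>2"] grow[OF i]
        by (simp add: power_mono)
      also have "\<dots> = (\<Sum>j\<in>{i..<i + N}. (norm (s $ j))\<^sup>2)"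
        by (rule sum.reindex_bij_witness[of _ "\<lambda>j. j - i" "\<lambda>j. i + j"]) auto
      also have "\<dots> \<le> sqsum (i + N) s"
        unfolding sqsum_def by (rule sum_mono2) auto
      also have "\<dots> \<le> sqsum (i + N) p"
        unfolding s_def by (rule contractive_fpsD[OF f])
      also have "\<dots> = sqsum m p"
        using i by (intro sqsum_deg_lt[OF p]) simp
      finally show ?thesis .
    qed
    show "s $ i = 0"
    proof (rule ccontr)
      assume "s $ i \<noteq> 0"
      then have "(norm (s $ i))\<^sup>2 > 0"
        by simp
      then obtain N where "sqsum m p < real N * (norm (s $ i))\<^sup>2"
        using reals_Archimedean3 by blast
      then show False
        using bound[of N] by simp
    qed
  qed
  text \<open>Modulo null vectors of the defect form, multiplication by \<open>z\<close> acts on \<open>p\<close> as the scalar \<open>b\<close>;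
    but \<open>p\<close> and \<open>z\<^sup>m p\<close> are orthogonal, hence \<open>p\<close> is itself a null vector.\<close>
  have "eventually_isometric f (fps_X ^ j * p - p * fps_const (b ^ j))" for j
  proof (induction j)
    case 0
    show ?case
      by (simp add: eventually_isometric_def)
  next
    case (Suc j)
    have "fps_X ^ Suc j * p - p * fps_const (b ^ Suc j)
        = fps_X * (fps_X ^ j * p - p * fps_const (b ^ j)) + t * fps_const (b ^ j)"
      by (simp add: t_def right_diff_distrib left_diff_distrib mult.assoc fps_mult_fps_X_commute)
    moreover have "eventually_isometric f t"
      using isometric_poly_eventually[OF f iso] by (simp add: t_def)
    ultimately show ?case
      using Suc f by (simp add: eventually_isometric_add eventually_isometric_X_mult
          eventually_isometric_mult_const)
  qed
  from this[of m] obtain N where N: "\<And>k. k \<ge> N \<Longrightarrow>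
      sqsum k (f * (fps_X ^ m * p - p * fps_const (b ^ m)))
      = sqsum k (fps_X ^ m * p - p * fps_const (b ^ m))"
    unfolding eventually_isometric_def by blast
  have "f * (fps_X ^ m * p - p * fps_const (b ^ m)) = fps_X ^ m * s - s * fps_const (b ^ m)"
    unfolding s_def right_diff_distrib
    by (metis fps_mult_fps_X_power_commute mult.assoc)
  then have "(1 + (norm (b ^ m))\<^sup>2) * sqsum m s = (1 + (norm (b ^ m))\<^sup>2) * sqsum m p"
    using N[of "max N (2 * m)"] sqsum_shift_diff[OF s] sqsum_shift_diff[OF p] by simp
  moreover have "1 + (norm (b ^ m))\<^sup>2 \<noteq> 0"
    using zero_le_power2[of "norm (b ^ m)"] by linarith
  ultimately show ?thesis
    using p by (simp add: isometric_poly_def s_def)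
qed

section \<open>Left division by linear factors and conjugate zeros\<close>

lemma deg_lt_left_division:
  fixes p :: "'a::ring_1 fps"
  assumes "deg_lt k p"
  shows "\<exists>q. deg_lt (k - 1) q \<and>
    p = (fps_X - fps_const a) * q + fps_const (\<Sum>i<k. a ^ i * p $ i)"
  using assms
proof (induction k arbitrary: p)
  case 0
  then show ?case
    by (auto simp: deg_lt_0_iff)
next
  case (Suc k)
  define p' where "p' = fps_shift 1 p"
  define u where "u = (\<Sum>i<k. a ^ i * p' $ i)"
  have "deg_lt k p'"
    using Suc.prems by (auto simp: deg_lt_def p'_def)
  from Suc.IH[OF this] obtain q where q: "deg_lt (k - 1) q"
    and p': "p' = (fps_X - fps_const a) * q + fps_const u"
    unfolding u_def by blast
  \<comment> \<open>Horner's scheme: p = p_0 + z p' and p' = (z - a) q + u give p = (z - a) (z q +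
    u) + (p_0 + a u).\<close>
  define r where "r = fps_X * q + fps_const u"
  have r: "deg_lt k r"
  proof (cases "k = 0")
    case True
    then show ?thesis
      using q by (simp add: deg_lt_0_iff r_def u_def)
  next
    case False
    then show ?thesis
      using q by (auto simp: deg_lt_def r_def)
  qed
  have rem: "(\<Sum>i<Suc k. a ^ i * p $ i) = p $ 0 + a * u"
    unfolding sum.lessThan_Suc_shift
    by (simp add: u_def p'_def sum_distrib_left mult.assoc)
  have "p $ n = ((fps_X - fps_const a) * r + fps_const (p $ 0 + a * u)) $ n" for n
  proof (cases n)
    case 0
    then show ?thesis
      by (simp add: r_def algebra_simps)
  next
    case (Suc i)
    have "p $ Suc i = p' $ i"
      by (simp add: p'_def)
    also have "\<dots> = r $ i - a * q $ i"
      unfolding p' fps_add_nth fps_linear_mult_nth by (simp add: r_def)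
    also have "q $ i = r $ Suc i"
      by (simp add: r_def)
    finally show ?thesis
      unfolding Suc fps_add_nth fps_linear_mult_nth by simp
  qed
  then have "p = (fps_X - fps_const a) * r + fps_const (p $ 0 + a * u)"
    by (rule fps_ext)
  with r show ?case
    unfolding rem by auto
qed

lemma fps_const_of_real_commute: "fps_const (of_real r) * p = p * fps_const (of_real r)"
  for p :: "'a::real_algebra_1 fps"
  by (simp add: fps_eq_iff of_real_def)

lemma fps_linear_mult_conj:
  "(fps_X - fps_const b) * (fps_X - fps_const (qcnj b))
   = fps_X\<^sup>2 - fps_const (of_real (2 * qRe b)) * fps_X + fps_const (of_real ((norm b)\<^sup>2))"
proof -
  have 1: "b + qcnj b = of_real (2 * qRe b)"
    by (simp add: quat_eq_iff of_real_def)
  have 2: "b * qcnj b = of_real ((norm b)\<^sup>2)"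
    using qcnj_mult_self[of "qcnj b"] by simp
  show ?thesis
    unfolding 1[symmetric] 2[symmetric]
    using fps_mult_fps_X_commute[of "fps_const (qcnj b)"]
    by (simp add: algebra_simps power2_eq_square flip: fps_const_add)
qed

lemma qRe_mult_commute: "qRe (a * b) = qRe (b * a)"
  by (simp add: quat_times_simps)

text \<open>The polynomial \<open>z\<^sup>2 - 2 Re(b) z + \<bar>b\<bar>\<^sup>2\<close> has real coefficients, hence is central, and it is divisible
  by \<open>z - c\<close> on either side for every conjugate \<open>c\<close> of \<open>b\<close>.\<close>

lemma left_linear_factor_imp_right:
  fixes p :: "quat fps"
  assumes "deg_lt m p"
  obtains q c where "deg_lt m q" "norm c = norm b"
    "(fps_X - fps_const b) * p = q * (fps_X - fps_const c)"
proof -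
  \<comment> \<open>Dividing by the factor of the conjugate of \<open>b\<close> makes (z - b) p the
    sum of a central multiple of \<open>q\<close> and (z - b) u.\<close>
  define u where "u = (\<Sum>i<m. (qcnj b) ^ i * p $ i)"
  from deg_lt_left_division[OF assms, of "qcnj b"]
  obtain q where q: "deg_lt (m - 1) q" "p = (fps_X - fps_const (qcnj b)) * q + fps_const u"
    unfolding u_def by blast
  \<comment> \<open>Moving \<open>u\<close> to the left of z - b turns \<open>b\<close> into this
    conjugate; for \<open>u = 0\<close> the choice is immaterial.\<close>
  define c where "c = (if u = 0 then b else inverse u * b * u)"
  have uc: "fps_const b * fps_const u = fps_const u * fps_const c"
    by (simp add: c_def mult.assoc[symmetric])
  have nc: "norm c = norm b"
    by (simp add: c_def norm_mult norm_inverse)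
  have "qRe (inverse u * (b * u)) = qRe b" if "u \<noteq> 0"
    using that by (subst qRe_mult_commute) (simp add: mult.assoc)
  then have rc: "qRe c = qRe b"
    by (simp add: c_def mult.assoc)
  define chi where "chi = (fps_X - fps_const b) * (fps_X - fps_const (qcnj b))"
  have chi: "chi = (fps_X - fps_const (qcnj c)) * (fps_X - fps_const c)"
    using fps_linear_mult_conj[of b] fps_linear_mult_conj[of "qcnj c"]
    by (simp add: chi_def rc nc)
  have linear: "fps_const (of_real r) * fps_X * q = q * (fps_const (of_real r) * fps_X)" for r
    by (metis fps_const_of_real_commute fps_mult_fps_X_commute mult.assoc)
  have comm: "chi * q = q * chi"
    unfolding chi_def fps_linear_mult_conj
    unfolding left_diff_distrib right_diff_distrib distrib_left distrib_right fps_const_of_real_commute[of _ q] fps_mult_fps_X_power_commute[of _ q]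
      linear ..
  have "(fps_X - fps_const b) * p = chi * q + (fps_X - fps_const b) * fps_const u"
    by (simp add: q(2) chi_def distrib_left mult.assoc)
  also have "(fps_X - fps_const b) * fps_const u = fps_const u * (fps_X - fps_const c)"
    unfolding left_diff_distrib right_diff_distrib uc fps_mult_fps_X_commute ..
  also have "chi * q + \<dots> = (q * (fps_X - fps_const (qcnj c)) + fps_const u) * (fps_X - fps_const c)"
    unfolding comm unfolding chi by (simp add: distrib_right mult.assoc)
  finally have eq: "(fps_X - fps_const b) * p
    = (q * (fps_X - fps_const (qcnj c)) + fps_const u) * (fps_X - fps_const c)" .
  have "deg_lt m (q * (fps_X - fps_const (qcnj c)) + fps_const u)"
  proof (cases "m = 0")
    case True
    then show ?thesis
      using q(1) by (simp add: deg_lt_0_iff u_def)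
  next
    case False
    then show ?thesis
      using q(1) unfolding deg_lt_def fps_add_nth fps_mult_linear_nth by auto
  qed
  then show ?thesis
    using that nc eq by blast
qed

text \<open>The left factor becomes a right factor of the same modulus, which
  \<open>isometric_poly_right_factor\<close> cancels; the missing order \<open>m\<close> then forces
  the quotient to be 0.\<close>

lemma isometric_poly_no_left_zero:
  assumes "contractive_fps f" and "\<not> has_isometric m f"
    and "isometric_poly (Suc m) f ((fps_X - fps_const b) * p)" and "deg_lt m p" and "norm b \<le> 1"
  shows "p = 0"
proof -
  obtain q c where q: "deg_lt m q" "norm c = norm b"
    "(fps_X - fps_const b) * p = q * (fps_X - fps_const c)"
    using left_linear_factor_imp_right[OF assms(4)] by blast
  have "isometric_poly m f q"
    using isometric_poly_right_factor[OF assms(1), of m q c] assms(3,5) q by simp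
  then have "q = 0"
    using assms(2) by (auto simp: has_isometric_def)
  then have "(fps_X - fps_const b) * p = 0"
    using q(3) by simp
  then show ?thesis
    by simp
qed

section \<open>Zeros of quaternionic polynomials\<close>

text \<open>\<open>quat_of_complexes u v\<close> is \<open>u + j v\<close>, so that right multiplication by complex numbers acts on
  \<open>u\<close> and \<open>v\<close> separately.\<close>

definition quat_of_complexes :: "complex \<Rightarrow> complex \<Rightarrow> quat" where
  "quat_of_complexes u v = Quat (Re u) (Im u) (Re v) (- Im v)"

lemma quat_of_complexes_cases:
  obtains u v where "q = quat_of_complexes u v"
  using that[of "Complex (qRe q) (qIm1 q)" "Complex (qIm2 q) (- qIm3 q)"]
  by (simp add: quat_of_complexes_def)

lemma quat_of_complexes_mult:
  "quat_of_complexes a b * quat_of_complexes u v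
   = quat_of_complexes (a * u - cnj b * v) (b * u + cnj a * v)"
  by (simp add: quat_of_complexes_def quat_eq_iff quat_times_simps algebra_simps)

lemma quat_of_complexes_add:
  "quat_of_complexes a b + quat_of_complexes u v = quat_of_complexes (a + u) (b + v)"
  by (simp add: quat_of_complexes_def quat_eq_iff)

lemma quat_of_complexes_eq_0_iff: "quat_of_complexes u v = 0 \<longleftrightarrow> u = 0 \<and> v = 0"
  by (auto simp: quat_of_complexes_def quat_eq_iff complex_eq_iff)

lemma quat_of_complexes_sum:
  "(\<Sum>i\<in>A. quat_of_complexes (g i) (h i)) = quat_of_complexes (sum g A) (sum h A)"
  by (induction A rule: infinite_finite_induct)
     (simp_all add: quat_of_complexes_add quat_of_complexes_eq_0_iff)

lemma quat_of_complexes_power: "quat_of_complexes z 0 ^ k = quat_of_complexes (z ^ k) 0"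
proof (induction k)
  case 0
  show ?case
    by (simp add: quat_of_complexes_def quat_eq_iff)
qed (simp add: quat_of_complexes_mult)

lemma coeff_mult_at_sum:
  assumes "degree p \<le> m" "degree q \<le> n"
  shows "coeff (p * q) (m + n) = coeff p m * coeff q n"
proof -
  have "coeff (p * q) (m + n) = (\<Sum>i\<le>m + n. if i = m then coeff p m * coeff q n else 0)"
    unfolding coeff_mult
  proof (rule sum.cong[OF refl])
    fix i
    show "coeff p i * coeff q (m + n - i) = (if i = m then coeff p m * coeff q n else 0)"
      using assms by (cases i m rule: linorder_cases) (auto simp: coeff_eq_0)
  qed
  then show ?thesis
    by simp
qed

text \<open>For complex \<open>z\<close> the sum is, in the two complex coordinates of
  \<open>h\<close>, a 2 by 2 linear system with entries polynomial in \<open>z\<close>. Its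
  determinant \<open>D\<close> has coefficient |a_m|^2 + |b_m|^2 > 0 at degree 2m, hence a root
  \<open>z\<close>, and there a nonzero \<open>h\<close> lies in the kernel.\<close>

lemma quat_polynomial_right_root:
  fixes c :: "nat \<Rightarrow> quat"
  assumes "c m \<noteq> 0" and "m \<ge> 1"
  obtains h z where "h \<noteq> 0" "(\<Sum>k\<le>m. c k * h * z ^ k) = 0"
proof -
  have "\<forall>k. \<exists>u v. c k = quat_of_complexes u v"
    by (metis quat_of_complexes_cases)
  then obtain a b where ab: "\<And>k. c k = quat_of_complexes (a k) (b k)"
    by metis
  define pol :: "(nat \<Rightarrow> complex) \<Rightarrow> complex poly" where "pol d = (\<Sum>k\<le>m. monom (d k) k)" for d
  have deg: "degree (pol d) \<le> m" for d
    unfolding pol_def by (rule degree_sum_le) (auto intro: order_trans[OF degree_monom_le])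
  have lead: "coeff (pol d) m = d m" for d
    by (simp add: pol_def coeff_sum)
  have ev: "poly (pol d) z = (\<Sum>k\<le>m. d k * z ^ k)" for d z
    by (simp add: pol_def poly_sum poly_monom)
  define A A' B B' where "A = pol a" and "A' = pol (\<lambda>k. cnj (a k))"
    and "B = pol b" and "B' = pol (\<lambda>k. cnj (b k))"
  define D where "D = A * A' + B * B'"
  have "coeff D (m + m) = of_real ((cmod (a m))\<^sup>2 + (cmod (b m))\<^sup>2)"
    unfolding of_real_add complex_norm_square
    by (simp add: D_def A_def A'_def B_def B'_def coeff_mult_at_sum deg lead)
  moreover have "a m \<noteq> 0 \<or> b m \<noteq> 0"
    using assms(1) by (simp add: ab quat_of_complexes_eq_0_iff)
  then have "(cmod (a m))\<^sup>2 + (cmod (b m))\<^sup>2 \<noteq> 0"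
    by (simp add: add_nonneg_eq_0_iff)
  ultimately have "coeff D (m + m) \<noteq> 0"
    by (metis of_real_eq_0_iff)
  then have "degree D \<noteq> 0"
    using le_degree[of D "m + m"] assms(2) by auto
  then obtain z where z: "poly D z = 0"
    using fundamental_theorem_of_algebra[of D] by (auto simp: constant_degree)
  define \<alpha> \<alpha>' \<beta> \<beta>' where "\<alpha> = poly A z" and "\<alpha>' = poly A' z" and "\<beta> = poly B z" and "\<beta>' = poly B' z"
  have det: "\<alpha> * \<alpha>' + \<beta> * \<beta>' = 0"
    using z by (simp add: D_def \<alpha>_def \<alpha>'_def \<beta>_def \<beta>'_def)
  \<comment> \<open>A kernel vector of the singular matrix: the vector annihilated by its second
    row, or, if that row is zero, one annihilated by the first.\<close>
  obtain u v where uv: "u \<noteq> 0 \<or> v \<noteq> 0" "\<alpha> * u - \<beta>' * v = 0" "\<beta> * u + \<alpha>' * v = 0"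
  proof (cases "\<alpha>' = 0 \<and> \<beta> = 0")
    case False
    then show ?thesis
      using that[of \<alpha>' "- \<beta>"] det by (auto simp: algebra_simps)
  next
    case True
    then show ?thesis
      using that[of \<beta>' \<alpha>] that[of 1 0] by (cases "\<alpha> = 0 \<and> \<beta>' = 0") auto
  qed
  have "(\<Sum>k\<le>m. c k * quat_of_complexes u v * quat_of_complexes z 0 ^ k)
      = quat_of_complexes (\<alpha> * u - \<beta>' * v) (\<beta> * u + \<alpha>' * v)"
    unfolding \<alpha>_def \<alpha>'_def \<beta>_def \<beta>'_def A_def A'_def B_def B'_def ev
    by (simp add: ab quat_of_complexes_power quat_of_complexes_mult quat_of_complexes_sum
        sum_distrib_left sum.distrib sum_subtractf algebra_simps)
  then show ?thesis
    using uv that[of "quat_of_complexes u v" "quat_of_complexes z 0"]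
    by (auto simp: quat_of_complexes_eq_0_iff)
qed

text \<open>Conjugating a right root makes the sum of the Z^k H p_k vanish. Since Z^k H = H a^k, the
  left value of \<open>p\<close> at \<open>a\<close>, which is the remainder of left division, is
  0.\<close>

lemma quat_polynomial_left_factor:
  fixes p :: "quat fps"
  assumes "deg_lt (Suc m) p" and "p $ m \<noteq> 0" and "m \<ge> 1"
  obtains a q where "deg_lt m q" "p = (fps_X - fps_const a) * q"
proof -
  obtain h z where h: "h \<noteq> 0" and hz: "(\<Sum>k\<le>m. qcnj (p $ k) * h * z ^ k) = 0"
    using quat_polynomial_right_root[of "\<lambda>k. qcnj (p $ k)" m] assms by auto
  define H Z where "H = qcnj h" and "Z = qcnj z"
  define a where "a = inverse H * Z * H"
  have H: "H \<noteq> 0"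
    using h by (simp add: H_def)
  have pow: "a ^ k = inverse H * Z ^ k * H" for k
  proof (induction k)
    case (Suc k)
    have "a ^ Suc k = a * (inverse H * Z ^ k * H)"
      by (simp only: power_Suc Suc)
    also have "\<dots> = inverse H * Z * (H * inverse H) * Z ^ k * H"
      by (simp only: a_def mult.assoc)
    finally show ?case
      using H by (simp add: mult.assoc)
  qed (use H in simp)
  have "qcnj (\<Sum>k\<le>m. qcnj (p $ k) * h * z ^ k) = (\<Sum>k\<le>m. Z ^ k * H * p $ k)"
    by (simp add: H_def Z_def mult.assoc)
  then have "(\<Sum>k\<le>m. Z ^ k * H * p $ k) = 0"
    using hz by simp
  then have "(\<Sum>k\<le>m. a ^ k * p $ k) = 0"
    unfolding pow by (simp add: mult.assoc flip: sum_distrib_left)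
  then have "(\<Sum>k<Suc m. a ^ k * p $ k) = 0"
    by (simp only: lessThan_Suc_atMost)
  then show ?thesis
    using deg_lt_left_division[OF assms(1), of a] that by auto
qed

section \<open>Blaschke factors\<close>

lemma fps_one_minus_mult_nth:
  "((1 - fps_const c * fps_X) * p) $ i = p $ i - c * (if i = 0 then 0 else p $ (i - 1))"
  for c :: "'a::ring_1"
  by (simp add: left_diff_distrib mult.assoc)

definition szego_kernel :: "quat \<Rightarrow> quat fps" where
  "szego_kernel \<alpha> = Abs_fps (\<lambda>k. qcnj \<alpha> ^ k)"

lemma blaschke_factor_eq: "blaschke_factor \<alpha> = (fps_X - fps_const \<alpha>) * szego_kernel \<alpha>"
  by (simp add: blaschke_factor_def szego_kernel_def)

lemma szego_kernel_inverse_left: "(1 - fps_const (qcnj \<alpha>) * fps_X) * szego_kernel \<alpha> = 1"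
proof (rule fps_ext)
  fix n
  show "((1 - fps_const (qcnj \<alpha>) * fps_X) * szego_kernel \<alpha>) $ n = (1 :: quat fps) $ n"
    unfolding fps_one_minus_mult_nth by (cases n) (simp_all add: szego_kernel_def)
qed

lemma szego_kernel_inverse_right: "szego_kernel \<alpha> * (1 - fps_const (qcnj \<alpha>) * fps_X) = 1"
proof (rule fps_ext)
  fix n
  have "szego_kernel \<alpha> * (fps_const (qcnj \<alpha>) * fps_X)
      = fps_X * (szego_kernel \<alpha> * fps_const (qcnj \<alpha>))"
    by (metis fps_mult_fps_X_commute mult.assoc)
  then show "(szego_kernel \<alpha> * (1 - fps_const (qcnj \<alpha>) * fps_X)) $ n = (1 :: quat fps) $ n"
    unfolding right_diff_distrib
    by (cases n) (simp_all add: szego_kernel_def power_commutes)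
qed

lemma qcnj_commute: "qcnj x * x = x * qcnj x"
  using qcnj_mult_self[of x] qcnj_mult_self[of "qcnj x"] by simp

text \<open>Conjugation reverses the two factors; their order is restored because \<alpha> commutes
  with its conjugate.\<close>

lemma fps_qcnj_blaschke_factor: "fps_qcnj (blaschke_factor \<alpha>) = blaschke_factor (qcnj \<alpha>)"
proof (rule fps_ext)
  fix n
  have "\<alpha> ^ n * qcnj \<alpha> = qcnj \<alpha> * \<alpha> ^ n"
    by (rule power_commuting_commutes) (rule qcnj_commute[symmetric])
  then show "fps_qcnj (blaschke_factor \<alpha>) $ n = blaschke_factor (qcnj \<alpha>) $ n"
    unfolding blaschke_factor_eq fps_qcnj_nth fps_linear_mult_nth
    by (cases n) (simp_all add: szego_kernel_def qcnj_minus power_commutes)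
qed

text \<open>With u = q_i and v = q_(i-1), the i-th coefficients contribute (1 - |\<alpha>|^2) (|u|^2
  - |v|^2) to the difference, and the sum telescopes.\<close>

lemma sqsum_blaschke_defect:
  "sqsum (Suc k) ((1 - fps_const (qcnj \<alpha>) * fps_X) * q)
   = sqsum (Suc k) ((fps_X - fps_const \<alpha>) * q) + (1 - (norm \<alpha>)\<^sup>2) * (norm (q $ k))\<^sup>2"
proof -
  have eq: "(norm (u - qcnj \<alpha> * v))\<^sup>2 - (norm (v - \<alpha> * u))\<^sup>2
    = (1 - (norm \<alpha>)\<^sup>2) * ((norm u)\<^sup>2 - (norm v)\<^sup>2)" for u v
  proof -
    have "inner u (qcnj \<alpha> * v) = inner (\<alpha> * u) v"
      by (simp add: mult.assoc flip: qRe_qcnj_mult)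
    then have i: "inner u (qcnj \<alpha> * v) = inner v (\<alpha> * u)"
      by (simp add: inner_commute)
    have "(norm (u - qcnj \<alpha> * v))\<^sup>2 = (norm u)\<^sup>2 + (norm \<alpha> * norm v)\<^sup>2 - 2 * inner v (\<alpha> * u)"
      using dot_norm_neg[of u "qcnj \<alpha> * v"] i by (simp add: norm_mult)
    moreover have "(norm (v - \<alpha> * u))\<^sup>2 = (norm v)\<^sup>2 + (norm \<alpha> * norm u)\<^sup>2 - 2 * inner v (\<alpha> * u)"
      using dot_norm_neg[of v "\<alpha> * u"] by (simp add: norm_mult)
    ultimately show ?thesis
      by (simp add: power_mult_distrib algebra_simps)
  qed
  show ?thesis
  proof (induction k)
    case 0
    show ?case
      unfolding sqsum_def sum.lessThan_Suc fps_linear_mult_nth fps_one_minus_mult_nth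
      by (simp add: norm_mult power_mult_distrib algebra_simps)
  next
    case (Suc k)
    then show ?case
      using eq[of "q $ Suc k" "q $ k"]
      unfolding sqsum_def sum.lessThan_Suc[of _ "Suc k"] fps_linear_mult_nth fps_one_minus_mult_nth
      by (simp add: algebra_simps del: sum.lessThan_Suc)
  qed
qed

text \<open>A Blaschke factor loses norm through a single functional of \<open>p\<close>; this is
  the source of the rank count.\<close>

lemma sqsum_blaschke_factor_mult:
  "sqsum (Suc k) p = sqsum (Suc k) (blaschke_factor \<alpha> * p)
     + (1 - (norm \<alpha>)\<^sup>2) * (norm ((szego_kernel \<alpha> * p) $ k))\<^sup>2"
  using sqsum_blaschke_defect[of k \<alpha> "szego_kernel \<alpha> * p"]
  by (simp add: blaschke_factor_eq szego_kernel_inverse_left flip: mult.assoc)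

lemma contractive_blaschke_factor:
  assumes "norm \<alpha> < 1"
  shows "contractive_fps (blaschke_factor \<alpha>)"
  unfolding contractive_fps_def
proof (intro allI)
  fix k p
  have "(norm \<alpha>)\<^sup>2 \<le> 1"
    using assms by (simp add: power_le_one)
  then show "sqsum k (blaschke_factor \<alpha> * p) \<le> sqsum k p"
    using sqsum_blaschke_factor_mult[of "k - 1" p \<alpha>] by (cases k) (simp_all add: sqsum_def)
qed

section \<open>Completeness and division of bounded series\<close>

instance quat :: banach
proof
  fix X :: "nat \<Rightarrow> quat"
  assume X: "Cauchy X"
  have le: "\<bar>qRe x\<bar> \<le> norm x" "\<bar>qIm1 x\<bar> \<le> norm x" "\<bar>qIm2 x\<bar> \<le> norm x" "\<bar>qIm3 x\<bar> \<le> norm x" for x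
    by (simp_all add: norm_quat_def real_le_rsqrt)
  have lin: "bounded_linear qRe" "bounded_linear qIm1" "bounded_linear qIm2" "bounded_linear qIm3"
    by (rule bounded_linear_intro[where K = 1]; simp add: le)+
  obtain a b c d where lim: "(\<lambda>n. qRe (X n)) \<longlonglongrightarrow> a" "(\<lambda>n. qIm1 (X n)) \<longlonglongrightarrow> b"
    "(\<lambda>n. qIm2 (X n)) \<longlonglongrightarrow> c" "(\<lambda>n. qIm3 (X n)) \<longlonglongrightarrow> d"
    using lin[THEN bounded_linear.Cauchy, OF X] unfolding Cauchy_convergent_iff convergent_def
    by blast
  have eq: "x = qRe x *\<^sub>R 1 + qIm1 x *\<^sub>R Quat 0 1 0 0 + qIm2 x *\<^sub>R Quat 0 0 1 0
    + qIm3 x *\<^sub>R Quat 0 0 0 1" for x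
    by (simp add: quat_eq_iff)
  have "(\<lambda>n. qRe (X n) *\<^sub>R 1 + qIm1 (X n) *\<^sub>R Quat 0 1 0 0 + qIm2 (X n) *\<^sub>R Quat 0 0 1 0
      + qIm3 (X n) *\<^sub>R Quat 0 0 0 1)
    \<longlonglongrightarrow> a *\<^sub>R 1 + b *\<^sub>R Quat 0 1 0 0 + c *\<^sub>R Quat 0 0 1 0 + d *\<^sub>R Quat 0 0 0 1"
    by (intro tendsto_intros lim)
  then show "convergent X"
    unfolding eq[symmetric] convergent_def by blast
qed

text \<open>The Horner sums are now infinite and converge because |a| < 1 and the coefficients of
  \<open>f\<close> are bounded. The bound on \<open>q\<close> later makes boundary terms tend to
  0.\<close>

lemma bounded_left_division:
  fixes f :: "'a::{real_normed_div_algebra, banach} fps"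
  assumes a: "norm a < 1" and f: "\<And>i. norm (f $ i) \<le> B"
  obtains q c where "f = (fps_X - fps_const a) * q + fps_const c"
    "\<And>i. norm (q $ i) \<le> B / (1 - norm a)"
proof -
  define q where "q = Abs_fps (\<lambda>i. \<Sum>j. a ^ j * f $ (Suc i + j))"
  have le: "norm (a ^ j * f $ i) \<le> B * norm a ^ j" for i j
    using mult_left_mono[OF f[of i], of "norm a ^ j"] by (simp add: norm_mult norm_power mult.commute)
  have geo: "summable (\<lambda>j. B * norm a ^ j)"
    using a by (simp add: summable_mult summable_geometric)
  have "summable (\<lambda>j. norm (a ^ j * f $ (i + j)))" for i
    by (rule summable_comparison_test'[OF geo, of 0]) (use le in simp)
  note summ = this summable_norm_cancel[OF this]
  have bound: "norm (q $ i) \<le> B / (1 - norm a)" for i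
  proof -
    have "norm (q $ i) \<le> (\<Sum>j. norm (a ^ j * f $ (Suc i + j)))"
      unfolding q_def fps_nth_Abs_fps by (rule summable_norm[OF summ(1)])
    also have "\<dots> \<le> (\<Sum>j. B * norm a ^ j)"
      by (rule suminf_le[OF le summ(1) geo])
    also have "\<dots> = B / (1 - norm a)"
      using a by (simp add: suminf_mult summable_geometric suminf_geometric)
    finally show ?thesis .
  qed
  have "(\<Sum>j. a ^ j * f $ (i + j)) = f $ i + a * q $ i" for i
  proof -
    have "(\<Sum>j. a ^ j * f $ (i + j)) = f $ i + (\<Sum>j. a ^ Suc j * f $ (i + Suc j))"
      using suminf_split_head[OF summ(2)[of i]] by (simp add: algebra_simps)
    also have "(\<Sum>j. a ^ Suc j * f $ (i + Suc j)) = a * q $ i"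
      using suminf_mult[OF summ(2)[of "Suc i"], of a] by (simp add: q_def mult.assoc)
    finally show ?thesis .
  qed
  note step = this
  have "f = (fps_X - fps_const a) * q + fps_const (\<Sum>j. a ^ j * f $ j)"
  proof (rule fps_ext)
    fix n
    show "f $ n = ((fps_X - fps_const a) * q + fps_const (\<Sum>j. a ^ j * f $ j)) $ n"
    proof (cases n)
      case 0
      then show ?thesis
        unfolding fps_add_nth fps_linear_mult_nth using step[of 0] by simp
    next
      case (Suc i)
      have "q $ i = f $ Suc i + a * q $ Suc i"
        using step[of "Suc i"] by (simp add: q_def)
      then show ?thesis
        unfolding Suc fps_add_nth fps_linear_mult_nth by simp
    qed
  qed
  then show ?thesis
    using that bound by blast
qed

text \<open>Iterating the recursion \<open>j\<close> times leaves a tail of at most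
  \<open>\<rho> ^ j * B\<close>.\<close>

lemma tendsto_zero_if_backward_contraction:
  fixes u v :: "nat \<Rightarrow> real"
  assumes v: "v \<longlonglongrightarrow> 0" and rec: "\<And>i. u i \<le> v i + \<rho> * u (Suc i)"
    and u: "\<And>i. 0 \<le> u i" "\<And>i. u i \<le> B" and \<rho>: "0 \<le> \<rho>" "\<rho> < 1"
  shows "u \<longlonglongrightarrow> 0"
proof (rule LIMSEQ_I)
  fix e :: real assume "0 < e"
  \<comment> \<open>Chosen so that d + \<rho> e/2 = e/2, which makes the bound reproduce itself
    under the recursion.\<close>
  define d where "d = e / 2 * (1 - \<rho>)"
  have "d > 0"
    using \<open>0 < e\<close> \<rho> by (simp add: d_def)
  then obtain N where N: "\<And>i. i \<ge> N \<Longrightarrow> \<bar>v i\<bar> < d"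
    using LIMSEQ_D[OF v \<open>d > 0\<close>] by auto
  have "u i < e" if i: "i \<ge> N" for i
  proof -
    have le: "u i \<le> e / 2 + \<rho> ^ j * B" for j
      using i
    proof (induction j arbitrary: i)
      case 0
      then show ?case
        using u(2)[of i] \<open>0 < e\<close> by simp
    next
      case (Suc j)
      have "u i \<le> d + \<rho> * (e / 2 + \<rho> ^ j * B)"
        using rec[of i] N[of i] mult_left_mono[OF Suc.IH[of "Suc i"] \<rho>(1)] Suc.prems by simp
      also have "\<dots> = e / 2 + \<rho> ^ Suc j * B"
        by (simp add: d_def field_simps)
      finally show ?case .
    qed
    have "(\<lambda>j. e / 2 + \<rho> ^ j * B) \<longlonglongrightarrow> e / 2 + 0 * B"
      using \<rho> by (intro tendsto_intros) simp_all
    then have "u i \<le> e / 2 + 0 * B"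
      by (rule LIMSEQ_le_const) (use le in blast)
    then show ?thesis
      using \<open>0 < e\<close> by simp
  qed
  then show "\<exists>N. \<forall>i\<ge>N. norm (u i - 0) < e"
    using u(1) by auto
qed

lemma norm_fps_mult_nth_le:
  fixes q x :: "quat fps"
  assumes "\<And>i. norm (q $ i) \<le> C" and "deg_lt k x"
  shows "norm ((q * x) $ i) \<le> C * (\<Sum>j<k. norm (x $ j))"
proof -
  have C: "0 \<le> C"
    using order_trans[OF norm_ge_zero assms(1)] .
  have "norm ((q * x) $ i) \<le> (\<Sum>l=0..i. norm (q $ (i - l)) * norm (x $ l))"
    unfolding fps_mult_nth by (subst sum.atLeastAtMost_rev) (auto intro!: sum_norm_le simp: norm_mult)
  also have "\<dots> \<le> (\<Sum>l=0..i. C * norm (x $ l))"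
    by (intro sum_mono mult_right_mono assms) simp
  also have "\<dots> \<le> (\<Sum>l\<in>{0..i} \<union> {..<k}. C * norm (x $ l))"
    by (rule sum_mono2) (use C in auto)
  also have "\<dots> = (\<Sum>l<k. C * norm (x $ l))"
    by (rule sum.mono_neutral_right) (use assms(2) in \<open>auto simp: deg_lt_def\<close>)
  finally show ?thesis
    by (simp add: sum_distrib_left)
qed

lemma deg_lt_cutoff [simp]: "deg_lt k (fps_cutoff k p)"
  by (simp add: deg_lt_def)

text \<open>By \<open>sqsum_blaschke_defect\<close> the squared norms of \<open>g * x\<close> and
  \<open>f * x\<close> differ at order K + 1 by a multiple of |w_K|^2, where w = q x. This tends to
  0, since Y = f x is square summable, w_i = Y_(i+1) + \<alpha> w_(i+1), and \<open>w\<close> is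
  bounded.\<close>

lemma contractive_blaschke_quotient:
  assumes f: "contractive_fps f" "f = (fps_X - fps_const \<alpha>) * q" and \<alpha>: "norm \<alpha> < 1"
    and q: "\<And>i. norm (q $ i) \<le> C"
  shows "contractive_fps ((1 - fps_const (qcnj \<alpha>) * fps_X) * q)"
  unfolding contractive_fps_def
proof (intro allI)
  fix k and p :: "quat fps"
  define g where "g = (1 - fps_const (qcnj \<alpha>) * fps_X) * q"
  \<comment> \<open>Truncation keeps the first \<open>k\<close> coefficients of \<open>g * p\<close>
    and bounds the norm of \<open>f * x\<close> uniformly in the order.\<close>
  define x where "x = fps_cutoff k p"
  define w where "w = q * x"
  define Y where "Y = f * x"
  have Y: "Y = (fps_X - fps_const \<alpha>) * w"
    by (simp add: Y_def w_def f(2) mult.assoc)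
  have Yle: "sqsum N Y \<le> sqsum k p" for N
  proof -
    have "sqsum N Y \<le> sqsum (max N k) x"
      unfolding Y_def by (meson contractive_fpsD[OF f(1)] sqsum_mono max.cobounded1 order_trans)
    also have "\<dots> = sqsum k p"
      unfolding x_def by (subst sqsum_deg_lt[of k]) simp_all
    finally show ?thesis .
  qed
  have "summable (\<lambda>i. (norm (Y $ i))\<^sup>2)"
    by (rule summableI_nonneg_bounded[of _ "sqsum k p"]) (use Yle in \<open>auto simp: sqsum_def\<close>)
  then have "(\<lambda>i. (norm (Y $ i))\<^sup>2) \<longlonglongrightarrow> 0"
    by (rule summable_LIMSEQ_zero)
  then have "(\<lambda>i. sqrt ((norm (Y $ i))\<^sup>2)) \<longlonglongrightarrow> sqrt 0"
    by (rule tendsto_real_sqrt)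
  then have "(\<lambda>i. norm (Y $ i)) \<longlonglongrightarrow> 0"
    by simp
  then have "(\<lambda>i. norm (w $ i)) \<longlonglongrightarrow> 0"
  proof (rule tendsto_zero_if_backward_contraction[OF LIMSEQ_Suc])
    fix i
    have "w $ i = Y $ Suc i + \<alpha> * w $ Suc i"
      unfolding Y fps_linear_mult_nth by simp
    then show "norm (w $ i) \<le> norm (Y $ Suc i) + norm \<alpha> * norm (w $ Suc i)"
      by (metis norm_mult norm_triangle_ineq)
    show "norm (w $ i) \<le> C * (\<Sum>j<k. norm (x $ j))"
      unfolding w_def by (rule norm_fps_mult_nth_le[OF q]) (simp add: x_def)
  qed (use \<alpha> in simp_all)
  then have "(\<lambda>K. sqsum k p + (1 - (norm \<alpha>)\<^sup>2) * (norm (w $ K))\<^sup>2)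
      \<longlonglongrightarrow> sqsum k p + (1 - (norm \<alpha>)\<^sup>2) * 0\<^sup>2"
    by (intro tendsto_intros)
  then have lim: "(\<lambda>K. sqsum k p + (1 - (norm \<alpha>)\<^sup>2) * (norm (w $ K))\<^sup>2) \<longlonglongrightarrow> sqsum k p"
    by simp
  have "sqsum k (g * p) \<le> sqsum k p + (1 - (norm \<alpha>)\<^sup>2) * (norm (w $ K))\<^sup>2" if "K \<ge> k" for K
  proof -
    have "sqsum k (g * p) = sqsum k (g * x)"
      by (rule sqsum_mult_cong) (simp add: x_def)
    also have "\<dots> \<le> sqsum (Suc K) (g * x)"
      using that by (intro sqsum_mono) simp
    also have "\<dots> = sqsum (Suc K) Y + (1 - (norm \<alpha>)\<^sup>2) * (norm (w $ K))\<^sup>2"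
      unfolding Y sqsum_blaschke_defect[symmetric] by (simp add: g_def w_def mult.assoc)
    finally show ?thesis
      using Yle[of "Suc K"] by simp
  qed
  then show "sqsum k ((1 - fps_const (qcnj \<alpha>) * fps_X) * q * p) \<le> sqsum k p"
    unfolding g_def[symmetric] by (intro LIMSEQ_le_const[OF lim]) blast
qed

section \<open>Splitting off a Blaschke factor\<close>

text \<open>Reversal turns z - a into 1 - a z, so that a zero outside the open disc becomes a zero
  in the closed disc.\<close>

lemma fps_flip_linear_mult:
  fixes p :: "'a::ring_1 fps"
  assumes "deg_lt m p"
  shows "fps_flip (Suc m) ((fps_X - fps_const a) * p) = (1 - fps_const a * fps_X) * fps_flip m p"
proof (rule fps_ext)
  fix n
  consider "n = 0" | "0 < n" "n < m" | "0 < n" "n = m" | "m < n"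
    by linarith
  then show "fps_flip (Suc m) ((fps_X - fps_const a) * p) $ n
      = ((1 - fps_const a * fps_X) * fps_flip m p) $ n"
    using assms unfolding fps_flip_nth fps_linear_mult_nth fps_one_minus_mult_nth
    by cases (auto simp: deg_lt_def)
qed

lemma fps_flip_one_minus_mult:
  fixes p :: "'a::ring_1 fps"
  assumes "deg_lt m p"
  shows "fps_flip (Suc m) ((1 - fps_const a * fps_X) * p) = (fps_X - fps_const a) * fps_flip m p"
proof (rule fps_ext)
  fix n
  consider "n = 0" | "0 < n" "n < m" | "0 < n" "n = m" | "m < n"
    by linarith
  then show "fps_flip (Suc m) ((1 - fps_const a * fps_X) * p) $ n
      = ((fps_X - fps_const a) * fps_flip m p) $ n"
    using assms unfolding fps_flip_nth fps_linear_mult_nth fps_one_minus_mult_nth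
    by cases (auto simp: deg_lt_def)
qed

lemma contractive_nth_le_1:
  assumes "contractive_fps f"
  shows "norm (f $ i) \<le> 1"
proof -
  have "(norm (f $ i))\<^sup>2 \<le> sqsum (Suc i) (f * 1)"
    using norm_nth_le_sqsum[of i "Suc i" f] by simp
  also have "\<dots> \<le> sqsum (Suc i) 1"
    by (rule contractive_fpsD[OF assms])
  also have "\<dots> = 1"
    unfolding sqsum_def sum.lessThan_Suc_shift by simp
  finally show ?thesis
    by (simp add: abs_square_le_1)
qed

text \<open>Left division of \<open>f\<close> leaves a constant \<open>c\<close>. If
  \<open>c\<close> were nonzero, then c p = (z - a) u with u = r - q p bounded. From
  \<open>m\<close> on the moduli of \<open>u\<close> do not decrease but tend to 0, so
  \<open>u\<close> is a polynomial and \<open>p\<close> has a left zero in the disc, which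
  \<open>isometric_poly_no_left_zero\<close> excludes.\<close>

lemma isometric_poly_bounded_left_factor:
  assumes f: "contractive_fps f" and min: "\<not> has_isometric m f"
    and p: "isometric_poly (Suc m) f p" "p \<noteq> 0"
    and r: "f * p = (fps_X - fps_const a) * r" "deg_lt m r" and a: "norm a < 1"
  obtains q where "f = (fps_X - fps_const a) * q" "\<And>i. norm (q $ i) \<le> 1 / (1 - norm a)"
proof -
  obtain q c where q: "f = (fps_X - fps_const a) * q + fps_const c"
    "\<And>i. norm (q $ i) \<le> 1 / (1 - norm a)"
    using bounded_left_division[OF a contractive_nth_le_1[OF f]] by blast
  have "c = 0"
  proof (rule ccontr)
    assume c: "c \<noteq> 0"
    define u where "u = r - q * p"
    have cp: "fps_const c * p = (fps_X - fps_const a) * u"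
      using r(1) unfolding q(1) u_def by (simp add: algebra_simps)
    have dp: "deg_lt (Suc m) p"
      using p(1) by (simp add: isometric_poly_def)
    have bound: "norm (u $ i) \<le> sqrt (sqsum m r) + 1 / (1 - norm a) * (\<Sum>j<Suc m. norm (p $ j))" for i
    proof -
      have "norm (r $ i) \<le> sqrt (sqsum m r)"
        using r(2) norm_nth_le_sqsum[of i m r]
        by (cases "i < m") (auto simp: deg_lt_def intro: real_le_rsqrt)
      moreover have "norm ((q * p) $ i) \<le> 1 / (1 - norm a) * (\<Sum>j<Suc m. norm (p $ j))"
        by (rule norm_fps_mult_nth_le[OF q(2) dp])
      ultimately show ?thesis
        unfolding u_def fps_sub_nth using norm_triangle_ineq4[of "r $ i" "(q * p) $ i"] by linarith
    qed
    have step: "u $ i = a * u $ Suc i" if "m \<le> i" for i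
    proof -
      have "(fps_const c * p) $ Suc i = 0"
        using dp that by (simp add: deg_lt_def)
      then show ?thesis
        unfolding cp fps_linear_mult_nth by simp
    qed
    have rec: "norm (u $ (m + i)) = norm a * norm (u $ (m + Suc i))" for i
      using step[of "m + i"] by (simp flip: norm_mult)
    have lim: "(\<lambda>i. norm (u $ (m + i))) \<longlonglongrightarrow> 0"
    proof (rule tendsto_zero_if_backward_contraction[where v = "\<lambda>_. 0" and \<rho> = "norm a", OF _ _ _ bound])
      show "norm (u $ (m + i)) \<le> 0 + norm a * norm (u $ (m + Suc i))" for i
        using rec[of i] by linarith
    qed (use a in simp_all)
    have "incseq (\<lambda>i. norm (u $ (m + i)))"
    proof (rule incseq_SucI)
      fix i
      show "norm (u $ (m + i)) \<le> norm (u $ (m + Suc i))"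
        using rec[of i] a mult_right_mono[of "norm a" 1 "norm (u $ (m + Suc i))"]
          norm_ge_zero[of "u $ (m + Suc i)"] by linarith
    qed
    then have "norm (u $ (m + i)) \<le> 0" for i
      using lim by (rule incseq_le)
    then have "u $ i = 0" if "m \<le> i" for i
      using that by (metis le_Suc_ex norm_le_zero_iff)
    then have u: "deg_lt m (fps_const (inverse c) * u)"
      by (simp add: deg_lt_def)
    define b where "b = inverse c * a * c"
    have nb: "norm b \<le> 1"
    proof -
      have "norm b = norm a * (inverse (norm c) * norm c)"
        by (simp only: b_def norm_mult norm_inverse mult_ac)
      then show ?thesis
        using c a by simp
    qed
    have "p = fps_const (inverse c) * (fps_const c * p)"
      using c by (simp flip: mult.assoc)
    also have "\<dots> = fps_const (inverse c) * (fps_X - fps_const a) * u"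
      unfolding cp by (simp add: mult.assoc)
    also have "fps_const (inverse c) * (fps_X - fps_const a)
        = (fps_X - fps_const b) * fps_const (inverse c)"
      using c fps_mult_fps_X_commute[of "fps_const (inverse c)"]
      by (simp add: b_def left_diff_distrib right_diff_distrib mult.assoc)
    finally have pb: "p = (fps_X - fps_const b) * (fps_const (inverse c) * u)"
      by (simp add: mult.assoc)
    have "fps_const (inverse c) * u = 0"
      using isometric_poly_no_left_zero[OF f min _ u nb] p(1) pb by simp
    then show False
      using pb p(2) by simp
  qed
  then show ?thesis
    using that q by simp
qed

lemma is_blaschke_product_0I: "norm \<phi> = 1 \<Longrightarrow> is_blaschke_product 0 (fps_const \<phi>)"
  by (auto simp: is_blaschke_product_def)

lemma is_blaschke_product_SucI:
  assumes "is_blaschke_product n g" "norm \<alpha> < 1"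
  shows "is_blaschke_product (Suc n) (blaschke_factor \<alpha> * g)"
proof -
  obtain \<alpha>s \<phi> where "length \<alpha>s = n" "\<forall>\<alpha>\<in>set \<alpha>s. norm \<alpha> < 1" "norm \<phi> = 1"
    "g = prod_list (map blaschke_factor \<alpha>s) * fps_const \<phi>"
    using assms(1) by (auto simp: is_blaschke_product_def)
  then show ?thesis
    unfolding is_blaschke_product_def using assms(2)
    by (intro exI[of _ "\<alpha> # \<alpha>s"] exI[of _ \<phi>]) (simp add: mult.assoc)
qed

lemma is_blaschke_product_if_has_isometric:
  "contractive_fps f \<Longrightarrow> has_isometric (Suc m) f \<Longrightarrow> \<exists>n. is_blaschke_product n f"
proof (induction m arbitrary: f)
  case 0
  obtain p where p: "p \<noteq> 0" "isometric_poly 1 f p"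
    using 0(2) by (auto simp: has_isometric_def)
  have "p $ 0 \<noteq> 0"
    using p by (metis One_nat_def deg_lt_def fps_ext fps_zero_nth isometric_poly_def less_one not_le)
  moreover have "(norm (f $ 0))\<^sup>2 * (norm (p $ 0))\<^sup>2 = (norm (p $ 0))\<^sup>2"
    using p(2) by (simp add: isometric_poly_def sqsum_def norm_mult power_mult_distrib)
  ultimately have sq: "(norm (f $ 0))\<^sup>2 = 1"
    by simp
  then have f0: "norm (f $ 0) = 1"
    by (simp add: power2_eq_1_iff)
      (metis neg_0_le_iff_le norm_ge_zero not_one_le_zero)
  \<comment> \<open>The image of the series 1 has norm at most 1, and f_0 alone uses this
    up.\<close>
  have "deg_lt 1 f"
  proof (rule deg_lt_if_sqsum)
    fix l :: nat assume l: "1 \<le> l"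
    have "sqsum l (f * 1) \<le> sqsum l 1"
      by (rule contractive_fpsD[OF 0(1)])
    also have "sqsum l 1 = sqsum 1 1"
      by (rule sqsum_deg_lt) (use l in \<open>auto simp: deg_lt_def\<close>)
    finally show "sqsum l f \<le> sqsum 1 f"
      by (simp add: sqsum_def sq)
  qed
  then have "f = fps_const (f $ 0)"
    by (auto simp: fps_eq_iff deg_lt_def)
  then show ?case
    using is_blaschke_product_0I[OF f0] by metis
next
  case (Suc m')
  define m where "m = Suc m'"
  note f = Suc.prems(1)
  show ?case
  proof (cases "has_isometric m f")
    case True
    then show ?thesis
      using Suc.IH[OF f] by (simp add: m_def)
  next
    case min: False
    obtain p where p: "p \<noteq> 0" "isometric_poly (Suc m) f p"
      using Suc.prems(2) by (auto simp: has_isometric_def m_def)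
    define r where "r = f * p"
    have dr: "deg_lt (Suc m) r"
      using isometric_poly_deg_lt_mult[OF f p(2)] by (simp add: r_def)
    have flip: "fps_qcnj f * fps_flip (Suc m) r = fps_flip (Suc m) p"
      "isometric_poly (Suc m) (fps_qcnj f) (fps_flip (Suc m) r)"
      using isometric_poly_flip[OF f p(2)] by (simp_all add: r_def)
    have min': "\<not> has_isometric m (fps_qcnj f)"
      using min has_isometric_qcnj_iff[OF f] by simp
    have r0: "r \<noteq> 0"
    proof
      assume "r = 0"
      then have "sqsum (Suc m) p = sqsum (Suc m) 0"
        using p(2) unfolding isometric_poly_def r_def by metis
      then have "sqsum (Suc m) p = 0"
        by (simp add: sqsum_eq_0_iff)
      then have "p $ i = 0" for i
        using p(2) by (cases "i < Suc m") (auto simp: sqsum_eq_0_iff isometric_poly_def deg_lt_def)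
      then have "p = 0"
        by (simp add: fps_eq_iff)
      then show False
        using p(1) by simp
    qed
    \<comment> \<open>Otherwise the constant coefficient of the reversed \<open>r\<close> vanishes,
      hence so does p_m, and \<open>p\<close> is isometric already at order
      \<open>m\<close>.\<close>
    have "r $ m \<noteq> 0"
    proof
      assume rm: "r $ m = 0"
      then have "fps_flip (Suc m) p $ 0 = 0"
        unfolding flip(1)[symmetric] by simp
      then have pm: "p $ m = 0"
        by simp
      have "deg_lt m p"
        using p(2) pm by (auto simp: deg_lt_def isometric_poly_def le_Suc_eq dest: le_imp_less_or_eq)
      moreover have "sqsum m r = sqsum m p"
        using p(2) pm rm by (simp add: isometric_poly_def r_def sqsum_def)
      ultimately show False
        using min p(1) by (auto simp: has_isometric_def isometric_poly_def r_def)
    qed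
    moreover have "m \<ge> 1"
      by (simp add: m_def)
    ultimately obtain \<alpha> r1 where r1: "deg_lt m r1" "r = (fps_X - fps_const \<alpha>) * r1"
      by (rule quat_polynomial_left_factor[OF dr])
    have r1_0: "r1 \<noteq> 0"
      using r0 r1 by auto
    \<comment> \<open>If |\<alpha>| >= 1, the reversed \<open>r\<close>, isometric for
      \<open>fps_qcnj f\<close>, has the left zero \<open>inverse \<alpha>\<close> in the closed
      disc.\<close>
    have \<alpha>: "norm \<alpha> < 1"
    proof (rule ccontr)
      assume "\<not> norm \<alpha> < 1"
      then have ge: "1 \<le> norm \<alpha>" and nz: "\<alpha> \<noteq> 0"
        by auto
      define s where "s = fps_const (- \<alpha>) * fps_flip m r1"
      have "(1 - fps_const \<alpha> * fps_X) * fps_flip m r1 = (fps_X - fps_const (inverse \<alpha>)) * s"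
        unfolding s_def mult.assoc[symmetric] using nz fps_mult_fps_X_commute[of "fps_const (- \<alpha>)"]
        by (simp add: left_diff_distrib right_diff_distrib flip: fps_const_neg)
      then have "fps_flip (Suc m) r = (fps_X - fps_const (inverse \<alpha>)) * s"
        unfolding r1(2) fps_flip_linear_mult[OF r1(1)] .
      moreover have "deg_lt m s"
        by (simp add: s_def deg_lt_def)
      moreover have "norm (inverse \<alpha>) \<le> 1"
        using ge by (simp add: norm_inverse inverse_le_1_iff)
      ultimately have "s = 0"
        using isometric_poly_no_left_zero[OF contractive_fps_qcnj[OF f] min', of "inverse \<alpha>" s] flip(2)
        by simp
      then have "fps_flip m r1 = 0"
        using nz by (simp add: s_def)
      then show False
        using r1_0 fps_flip_eq_0_iff[OF r1(1)] by simp
    qed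
    obtain q where q: "f = (fps_X - fps_const \<alpha>) * q" "\<And>i. norm (q $ i) \<le> 1 / (1 - norm \<alpha>)"
      using isometric_poly_bounded_left_factor[OF f min p(2,1) _ r1(1) \<alpha>] r1(2) r_def by metis
    define g where "g = (1 - fps_const (qcnj \<alpha>) * fps_X) * q"
    have g: "contractive_fps g"
      unfolding g_def by (rule contractive_blaschke_quotient[OF f q(1) \<alpha> q(2)])
    have fg: "f = blaschke_factor \<alpha> * g"
    proof -
      have "blaschke_factor \<alpha> * g
          = (fps_X - fps_const \<alpha>) * (szego_kernel \<alpha> * (1 - fps_const (qcnj \<alpha>) * fps_X)) * q"
        by (simp add: blaschke_factor_eq g_def mult.assoc)
      then show ?thesis
        by (simp add: szego_kernel_inverse_right q(1))
    qed
    have "(fps_X - fps_const \<alpha>) * (q * p) = (fps_X - fps_const \<alpha>) * r1"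
      using r1(2) unfolding r_def q(1) by (simp add: mult.assoc)
    then have qp: "q * p = r1"
      by simp
    then have gp: "g * p = (1 - fps_const (qcnj \<alpha>) * fps_X) * r1"
      by (simp add: g_def mult.assoc)
    \<comment> \<open>The defect term vanishes because \<open>r1\<close> has degree less than
      \<open>m\<close>; so \<open>p\<close> is isometric for \<open>g\<close>, but still at order m
      + 1.\<close>
    have "sqsum (Suc m) (g * p) = sqsum (Suc m) r + (1 - (norm \<alpha>)\<^sup>2) * (norm (r1 $ m))\<^sup>2"
      unfolding gp sqsum_blaschke_defect r1(2) ..
    also have "\<dots> = sqsum (Suc m) p"
      using r1(1) p(2) by (simp add: deg_lt_def isometric_poly_def r_def)
    finally have isog: "isometric_poly (Suc m) g p"
      using p(2) by (simp add: isometric_poly_def)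
    have "isometric_poly (Suc m) (fps_qcnj g) (fps_flip (Suc m) (g * p))"
      by (rule isometric_poly_flip(2)[OF g isog])
    then have isog': "isometric_poly (Suc m) (fps_qcnj g) ((fps_X - fps_const (qcnj \<alpha>)) * fps_flip m r1)"
      unfolding gp fps_flip_one_minus_mult[OF r1(1)] .
    \<comment> \<open>The order drops because the reversed image \<open>g * p\<close> has the left
      zero \<open>qcnj \<alpha>\<close> in the disc, which is impossible at a minimal order.\<close>
    have "has_isometric m g"
    proof (rule ccontr)
      assume "\<not> has_isometric m g"
      then have "\<not> has_isometric m (fps_qcnj g)"
        using has_isometric_qcnj_iff[OF g] by simp
      then have "fps_flip m r1 = 0"
        using isometric_poly_no_left_zero[OF contractive_fps_qcnj[OF g] _ isog'] \<alpha> by simp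
      then show False
        using r1_0 fps_flip_eq_0_iff[OF r1(1)] by simp
    qed
    then obtain n where "is_blaschke_product n g"
      using Suc.IH[OF g] by (auto simp: m_def)
    then show ?thesis
      using is_blaschke_product_SucI[OF _ \<alpha>] fg by blast
  qed
qed

section \<open>Ranks of Pick matrices\<close>

lemma contractive_fps_const: "norm c \<le> 1 \<Longrightarrow> contractive_fps (fps_const c)"
  unfolding contractive_fps_def sqsum_const_mult
  by (simp add: mult_left_le_one_le power_le_one)

text \<open>Blaschke products with the unimodular factor and the recursion on the other side: these are
  the images of Blaschke products under \<^term>\<open>fps_qcnj\<close>.\<close>

inductive dual_blaschke :: "nat \<Rightarrow> quat fps \<Rightarrow> bool" where
  const: "norm \<phi> = 1 \<Longrightarrow> dual_blaschke 0 (fps_const \<phi>)"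
| mult: "dual_blaschke n g \<Longrightarrow> norm \<alpha> < 1 \<Longrightarrow> dual_blaschke (Suc n) (g * blaschke_factor \<alpha>)"

lemma dual_blaschke_fps_qcnj:
  assumes "is_blaschke_product n f"
  shows "dual_blaschke n (fps_qcnj f)"
proof -
  obtain \<alpha>s \<phi> where \<alpha>s: "length \<alpha>s = n" "\<forall>\<alpha>\<in>set \<alpha>s. norm \<alpha> < 1" "norm \<phi> = 1"
    and f: "f = prod_list (map blaschke_factor \<alpha>s) * fps_const \<phi>"
    using assms by (auto simp: is_blaschke_product_def)
  show ?thesis
    unfolding f using \<alpha>s
  proof (induction \<alpha>s arbitrary: n)
    case Nil
    then show ?case
      by (auto intro: dual_blaschke.const)
  next
    case (Cons \<alpha> \<alpha>s)
    then show ?case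
      by (auto simp: mult.assoc fps_qcnj_mult[of "blaschke_factor \<alpha>"] fps_qcnj_blaschke_factor
          intro!: dual_blaschke.mult)
  qed
qed

lemma contractive_dual_blaschke: "dual_blaschke n h \<Longrightarrow> contractive_fps h"
  by (induction rule: dual_blaschke.induct)
     (simp_all add: contractive_fps_const contractive_fps_mult contractive_blaschke_factor)

text \<open>If the product of two contractions preserves the norm of \<open>u\<close>, both do. The
  defect of the last factor then vanishes at all large orders, so w =
  \<open>szego_kernel \<alpha> * u\<close> has degree less than \<open>n\<close>. Now (z - \<alpha>)
  w is isometric for \<open>g\<close> with a zero in the disc, so the induction hypothesis and
  \<open>isometric_poly_no_left_zero\<close> give w = 0.\<close>

lemma dual_blaschke_no_isometric: "dual_blaschke n h \<Longrightarrow> \<not> has_isometric n h"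
proof (induction rule: dual_blaschke.induct)
  case (const \<phi>)
  then show ?case
    by (simp add: has_isometric_def isometric_poly_def deg_lt_0_iff)
next
  case (mult n g \<alpha>)
  define b where "b = blaschke_factor \<alpha>"
  have g: "contractive_fps g" and b: "contractive_fps b"
    using mult by (simp_all add: contractive_dual_blaschke contractive_blaschke_factor b_def)
  have gb: "contractive_fps (g * b)"
    by (rule contractive_fps_mult[OF g b])
  have "u = 0" if u: "isometric_poly (Suc n) (g * b) u" for u
  proof -
    define w where "w = szego_kernel \<alpha> * u"
    have bu: "b * u = (fps_X - fps_const \<alpha>) * w"
      by (simp add: b_def blaschke_factor_eq w_def mult.assoc)
    have sq: "sqsum k (b * u) = sqsum k u \<and> sqsum k (g * (b * u)) = sqsum k u" if "Suc n \<le> k" for k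
    proof -
      have "sqsum k (g * (b * u)) = sqsum k u"
        using isometric_poly_mono[OF gb u that] by (simp add: isometric_poly_def mult.assoc)
      then show ?thesis
        using contractive_fpsD[OF g, of k "b * u"] contractive_fpsD[OF b, of k u] by linarith
    qed
    have "w $ k = 0" if "n \<le> k" for k
    proof -
      have "(1 - (norm \<alpha>)\<^sup>2) * (norm (w $ k))\<^sup>2 = 0"
        using sqsum_blaschke_factor_mult[of k u \<alpha>] sq[of "Suc k"] that
        by (simp add: b_def w_def)
      moreover have "(norm \<alpha>)\<^sup>2 < 1"
        using mult(2) by (simp add: abs_square_less_1)
      ultimately show ?thesis
        by simp
    qed
    then have w: "deg_lt n w"
      by (simp add: deg_lt_def)
    have "isometric_poly (Suc n) b u"
      using u sq[of "Suc n"] by (simp add: isometric_poly_def)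
    then have "deg_lt (Suc n) (b * u)"
      by (rule isometric_poly_deg_lt_mult[OF b])
    then have "isometric_poly (Suc n) g (b * u)"
      using sq[of "Suc n"] by (simp add: isometric_poly_def)
    then have "w = 0"
      using isometric_poly_no_left_zero[OF g mult(3) _ w, of \<alpha>] bu mult(2) by simp
    have "u = (1 - fps_const (qcnj \<alpha>) * fps_X) * szego_kernel \<alpha> * u"
      by (simp only: szego_kernel_inverse_left mult_1_left)
    also have "\<dots> = (1 - fps_const (qcnj \<alpha>) * fps_X) * w"
      by (simp add: w_def mult.assoc)
    finally show "u = 0"
      by (simp add: \<open>w = 0\<close>)
  qed
  then show ?case
    unfolding has_isometric_def b_def by blast
qed

section \<open>Linear conditions bounding the rank from above\<close>

definition right_linear :: "(quat fps \<Rightarrow> quat) \<Rightarrow> bool" where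
  "right_linear L \<longleftrightarrow>
     (\<forall>x y. L (x + y) = L x + L y) \<and> (\<forall>x c. L (x * fps_const c) = L x * c)"

lemma right_linear_combination:
  assumes "right_linear L" and "finite J"
  shows "L (\<Sum>j\<in>J. x j * fps_const (c j)) = (\<Sum>j\<in>J. L (x j) * c j)"
  using assms(2)
proof (induction J rule: finite_induct)
  case empty
  have "L (0 * fps_const 0) = L 0 * 0"
    using assms(1) unfolding right_linear_def by blast
  then show ?case
    by simp
qed (use assms(1) in \<open>simp add: right_linear_def\<close>)

text \<open>Each Blaschke factor adds the functional of its own defect; those for \<open>g\<close>
  are pulled back along multiplication by the new factor.\<close>

lemma dual_blaschke_functionals:
  assumes "dual_blaschke n h"
  shows "\<exists>Ls. length Ls = n \<and> (\<forall>L\<in>set Ls. right_linear L) \<and>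
    (\<forall>x. (\<forall>L\<in>set Ls. L x = 0) \<longrightarrow> sqsum (Suc k) (h * x) = sqsum (Suc k) x)"
  using assms
proof (induction rule: dual_blaschke.induct)
  case (const \<phi>)
  then show ?case
    by (simp add: sqsum_const_mult)
next
  case (mult n g \<alpha>)
  then obtain Ls where Ls: "length Ls = n" "\<And>L. L \<in> set Ls \<Longrightarrow> right_linear L"
    "\<And>x. (\<forall>L\<in>set Ls. L x = 0) \<Longrightarrow> sqsum (Suc k) (g * x) = sqsum (Suc k) x"
    by blast
  define b where "b = blaschke_factor \<alpha>"
  define Ls' where "Ls' = (\<lambda>x. (szego_kernel \<alpha> * x) $ k) # map (\<lambda>L x. L (b * x)) Ls"
  have "right_linear (\<lambda>x. (szego_kernel \<alpha> * x) $ k)"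
    unfolding right_linear_def by (simp add: distrib_left flip: mult.assoc)
  moreover have "right_linear (\<lambda>x. L (b * x))" if "L \<in> set Ls" for L
    using Ls(2)[OF that] unfolding right_linear_def by (simp add: distrib_left flip: mult.assoc)
  moreover have "sqsum (Suc k) (g * b * x) = sqsum (Suc k) x" if x: "\<forall>L\<in>set Ls'. L x = 0" for x
  proof -
    have "sqsum (Suc k) (g * (b * x)) = sqsum (Suc k) (b * x)"
      using x by (intro Ls(3)) (simp add: Ls'_def)
    also have "\<dots> = sqsum (Suc k) x"
      using x sqsum_blaschke_factor_mult[of k x \<alpha>] by (simp add: Ls'_def b_def)
    finally show ?thesis
      by (simp add: mult.assoc)
  qed
  ultimately show ?case
    using Ls(1) unfolding b_def[symmetric] by (intro exI[of _ Ls']) (auto simp: Ls'_def)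
qed

text \<open>Gaussian elimination works over a skew field: row operations multiply from the left, the
  unknowns stand on the right.\<close>

lemma exists_nontrivial_right_solution:
  fixes a :: "nat \<Rightarrow> 'b \<Rightarrow> 'a::division_ring"
  assumes "finite J" and "M < card J"
  shows "\<exists>c. (\<exists>j\<in>J. c j \<noteq> 0) \<and> (\<forall>i<M. (\<Sum>j\<in>J. a i j * c j) = 0)"
  using assms
proof (induction M arbitrary: a J)
  case 0
  then have "J \<noteq> {}"
    by auto
  then show ?case
    by (intro exI[of _ "\<lambda>_. 1"]) auto
next
  case (Suc M)
  show ?case
  proof (cases "\<forall>j\<in>J. a M j = 0")
    case True
    then show ?thesis
      using Suc.IH[of J a] Suc.prems by (auto simp: less_Suc_eq)
  next
    case False
    then obtain s where s: "s \<in> J" "a M s \<noteq> 0"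
      by blast
    define J' where "J' = J - {s}"
    have J': "finite J'" "M < card J'" "s \<notin> J'" "J = insert s J'"
      using Suc.prems s(1) by (auto simp: J'_def)
    obtain c where c: "\<exists>j\<in>J'. c j \<noteq> 0"
      "\<And>i. i < M \<Longrightarrow> (\<Sum>j\<in>J'. (a i j - a i s * inverse (a M s) * a M j) * c j) = 0"
      using Suc.IH[OF J'(1,2), of "\<lambda>i j. a i j - a i s * inverse (a M s) * a M j"] by blast
    define t where "t = - (inverse (a M s) * (\<Sum>j\<in>J'. a M j * c j))"
    define d where "d = c(s := t)"
    have sum: "(\<Sum>j\<in>J. a i j * d j) = a i s * t + (\<Sum>j\<in>J'. a i j * c j)" for i
    proof -
      have "(\<Sum>j\<in>J'. a i j * d j) = (\<Sum>j\<in>J'. a i j * c j)"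
        using J'(3) by (intro sum.cong) (auto simp: d_def)
      then show ?thesis
        using J'(1,3) by (simp add: J'(4) d_def)
    qed
    have "(\<Sum>j\<in>J. a i j * d j) = 0" if "i < Suc M" for i
    proof (cases "i = M")
      case True
      then show ?thesis
        unfolding sum t_def using s(2) by (simp flip: mult.assoc)
    next
      case False
      then have "(\<Sum>j\<in>J'. a i j * c j) = a i s * inverse (a M s) * (\<Sum>j\<in>J'. a M j * c j)"
        using c(2)[of i] that by (simp add: left_diff_distrib sum_subtractf sum_distrib_left mult.assoc)
      then show ?thesis
        unfolding sum t_def by (simp add: mult.assoc)
    qed
    moreover have "\<exists>j\<in>J. d j \<noteq> 0"
      using c(1) J'(3,4) by (auto simp: d_def)
    ultimately show ?thesis
      by blast
  qed
qed

lemma qrank_eqI: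
  assumes "J \<subseteq> {..<dim_col A}" "right_indep_cols A J" "card J = r"
    and "\<And>J. J \<subseteq> {..<dim_col A} \<Longrightarrow> right_indep_cols A J \<Longrightarrow> card J \<le> r"
  shows "qrank A = r"
  unfolding qrank_def
proof (rule Max_eqI)
  have "{card J |J. J \<subseteq> {..<dim_col A} \<and> right_indep_cols A J} \<subseteq> card ` Pow {..<dim_col A}"
    by auto
  then show "finite {card J |J. J \<subseteq> {..<dim_col A} \<and> right_indep_cols A J}"
    by (rule finite_subset) simp
qed (use assms in auto)

lemma right_indep_cols_card_le_qrank:
  assumes "J \<subseteq> {..<dim_col A}" "right_indep_cols A J"
  shows "card J \<le> qrank A"
  unfolding qrank_def
proof (rule Max_ge)
  have "{card J |J. J \<subseteq> {..<dim_col A} \<and> right_indep_cols A J} \<subseteq> card ` Pow {..<dim_col A}"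
    by auto
  then show "finite {card J |J. J \<subseteq> {..<dim_col A} \<and> right_indep_cols A J}"
    by (rule finite_subset) simp
qed (use assms in auto)

text \<open>In the first \<open>k\<close> coefficients this is x - T T* x for the Toeplitz matrix T
  of \<open>f\<close>; multiplication between the reversals is T*.\<close>

definition pick_form :: "nat \<Rightarrow> quat fps \<Rightarrow> quat fps \<Rightarrow> quat fps" where
  "pick_form k f x = x - f * fps_flip k (fps_qcnj f * fps_flip k x)"

lemma dim_pick_matrix [simp]: "dim_row (pick_matrix k f) = k" "dim_col (pick_matrix k f) = k"
  by (simp_all add: pick_matrix_def toeplitz_def qadjoint_def)

lemma pick_matrix_entry:
  assumes "i < k" "j < k"
  shows "pick_matrix k f $$ (i, j) = (if i = j then 1 else 0) -
    (\<Sum>l<k. (if l \<le> i then f $ (i - l) else 0) * qcnj (if l \<le> j then f $ (j - l) else 0))"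
  using assms
  by (simp add: pick_matrix_def toeplitz_def qadjoint_def scalar_prod_def lessThan_atLeast0 cong: if_cong)

lemma pick_matrix_mult:
  assumes "i < k"
  shows "(\<Sum>j<k. pick_matrix k f $$ (i, j) * x $ j) = pick_form k f x $ i"
proof -
  define T where "T = (\<lambda>i l. if l \<le> i then f $ (i - l) else 0)"
  have y: "fps_flip k (fps_qcnj f * fps_flip k x) $ l = (\<Sum>j<k. qcnj (T j l) * x $ j)" if "l < k" for l
    unfolding fps_flip_mult_flip_nth[OF that] by (intro sum.cong) (auto simp: T_def)
  have entry: "pick_matrix k f $$ (i, j) = (if i = j then 1 else 0) - (\<Sum>l<k. T i l * qcnj (T j l))"
    if "j < k" for j
    unfolding pick_matrix_entry[OF assms that] T_def ..
  have swap: "(\<Sum>j<k. \<Sum>l<k. T i l * (qcnj (T j l) * x $ j)) = (\<Sum>l<k. \<Sum>j<k. T i l * (qcnj (T j l) * x $ j))"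
    by (rule sum.swap)
  have "(\<Sum>j<k. pick_matrix k f $$ (i, j) * x $ j)
      = (\<Sum>j<k. (if i = j then x $ j else 0) - (\<Sum>l<k. T i l * (qcnj (T j l) * x $ j)))"
    by (intro sum.cong) (simp_all add: entry left_diff_distrib sum_distrib_right mult.assoc)
  also have "\<dots> = x $ i - (\<Sum>l<k. T i l * (\<Sum>j<k. qcnj (T j l) * x $ j))"
    using assms by (simp add: sum_subtractf sum_distrib_left swap)
  also have "(\<Sum>l<k. T i l * (\<Sum>j<k. qcnj (T j l) * x $ j))
      = (f * fps_flip k (fps_qcnj f * fps_flip k x)) $ i"
    unfolding fps_mult_nth_toeplitz[OF assms]
    by (intro sum.cong refl) (simp only: lessThan_iff y, simp only: T_def)
  finally show ?thesis
    by (simp add: pick_form_def)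
qed

lemma qdot_pick_form:
  "qdot k x (pick_form k f x) = of_real (sqsum k x - sqsum k (fps_qcnj f * fps_flip k x))"
proof -
  have "qdot k x (pick_form k f x) = qdot k x x - qdot k x (f * fps_flip k (fps_qcnj f * fps_flip k x))"
    by (simp add: qdot_def pick_form_def right_diff_distrib sum_subtractf)
  then show ?thesis
    unfolding qdot_mult_right qdot_self by simp
qed

text \<open>A kernel vector annihilates the quadratic form |x|^2 - |T* x|^2; the converse is
  \<open>isometric_adjoint_nth\<close> for \<open>fps_qcnj f\<close>.\<close>

lemma pick_form_eq_0_iff:
  assumes "contractive_fps f"
  shows "(\<forall>i<k. pick_form k f x $ i = 0) \<longleftrightarrow> sqsum k (fps_qcnj f * fps_flip k x) = sqsum k x"
proof
  assume "\<forall>i<k. pick_form k f x $ i = 0"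
  then have "qdot k x (pick_form k f x) = 0"
    by (simp add: qdot_def)
  then have "sqsum k x - sqsum k (fps_qcnj f * fps_flip k x) = 0"
    unfolding qdot_pick_form by (simp only: of_real_eq_0_iff)
  then show "sqsum k (fps_qcnj f * fps_flip k x) = sqsum k x"
    by simp
next
  assume "sqsum k (fps_qcnj f * fps_flip k x) = sqsum k x"
  then have "(f * fps_flip k (fps_qcnj f * fps_flip k x)) $ i = x $ i" if "i < k" for i
    using isometric_adjoint_nth[OF contractive_fps_qcnj[OF assms], of k "fps_flip k x" i] that by simp
  then show "\<forall>i<k. pick_form k f x $ i = 0"
    by (simp add: pick_form_def)
qed

lemma qadjoint_pick_matrix: "qadjoint (pick_matrix k f) = pick_matrix k f"
proof (rule eq_matI)
  fix i j assume "i < dim_row (pick_matrix k f)" "j < dim_col (pick_matrix k f)"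
  then show "qadjoint (pick_matrix k f) $$ (i, j) = pick_matrix k f $$ (i, j)"
    by (auto simp: qadjoint_def pick_matrix_entry intro!: sum.cong)
qed (simp_all add: qadjoint_def)

lemma pick_matrix_quadratic_form:
  assumes "x \<in> carrier_vec k"
  shows "scalar_prod (map_vec qcnj x) (pick_matrix k f *\<^sub>v x)
    = qdot k (Abs_fps (vec_index x)) (pick_form k f (Abs_fps (vec_index x)))"
  using assms unfolding qdot_def
  by (simp add: scalar_prod_def lessThan_atLeast0[symmetric] pick_matrix_mult[symmetric])

text \<open>The quadratic form of the Pick matrix is |x|^2 - |T* x|^2, and reversal, which turns T*
  into multiplication by \<open>fps_qcnj f\<close>, preserves norms.\<close>

lemma qcontractive_toeplitz_iff:
  "qcontractive (toeplitz k f) \<longleftrightarrow> (\<forall>p. sqsum k (fps_qcnj f * p) \<le> sqsum k p)"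
proof -
  have eq: "qcontractive (toeplitz k f) \<longleftrightarrow>
    (\<forall>x\<in>carrier_vec k. \<exists>r\<ge>0. scalar_prod (map_vec qcnj x) (pick_matrix k f *\<^sub>v x) = of_real r)"
    unfolding qcontractive_def qpos_semidef_def
    using qadjoint_pick_matrix[of k f]
    by (simp add: toeplitz_def pick_matrix_def[symmetric, unfolded toeplitz_def])
  show ?thesis
  proof
    assume psd: "qcontractive (toeplitz k f)"
    show "\<forall>p. sqsum k (fps_qcnj f * p) \<le> sqsum k p"
    proof
      fix p :: "quat fps"
      define x where "x = vec k (\<lambda>i. fps_flip k p $ i)"
      define X where "X = Abs_fps (vec_index x)"
      have X: "X $ i = p $ (k - Suc i)" if "i < k" for i
        using that by (simp add: X_def x_def)
      have "x \<in> carrier_vec k"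
        by (simp add: x_def)
      then obtain r where "r \<ge> 0"
        and r: "scalar_prod (map_vec qcnj x) (pick_matrix k f *\<^sub>v x) = of_real r"
        using psd unfolding eq by blast
      have "of_real (sqsum k X - sqsum k (fps_qcnj f * fps_flip k X)) = (of_real r :: quat)"
        using r unfolding pick_matrix_quadratic_form[OF \<open>x \<in> carrier_vec k\<close>] X_def qdot_pick_form .
      then have "sqsum k X - sqsum k (fps_qcnj f * fps_flip k X) = r"
        by (simp only: of_real_eq_iff)
      then have "sqsum k (fps_qcnj f * fps_flip k X) \<le> sqsum k X"
        using \<open>r \<ge> 0\<close> by simp
      also have "sqsum k X = sqsum k (fps_flip k p)"
        by (rule sqsum_cong) (simp add: X)
      also have "sqsum k (fps_qcnj f * fps_flip k X) = sqsum k (fps_qcnj f * p)"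
        by (rule sqsum_mult_cong) (simp add: X)
      finally show "sqsum k (fps_qcnj f * p) \<le> sqsum k p"
        by simp
    qed
  next
    assume c: "\<forall>p. sqsum k (fps_qcnj f * p) \<le> sqsum k p"
    show "qcontractive (toeplitz k f)"
      unfolding eq
    proof (intro ballI exI conjI)
      fix x :: "quat vec" assume x: "x \<in> carrier_vec k"
      define X where "X = Abs_fps (vec_index x)"
      show "scalar_prod (map_vec qcnj x) (pick_matrix k f *\<^sub>v x)
        = of_real (sqsum k X - sqsum k (fps_qcnj f * fps_flip k X))"
        unfolding pick_matrix_quadratic_form[OF x] X_def qdot_pick_form ..
      show "0 \<le> sqsum k X - sqsum k (fps_qcnj f * fps_flip k X)"
        using c[rule_format, of "fps_flip k X"] by simp
    qed
  qed
qed

lemma contractive_fps_iff_qcontractive: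
  "contractive_fps f \<longleftrightarrow> (\<forall>k\<ge>1. qcontractive (toeplitz k f))"
proof -
  have "contractive_fps (fps_qcnj f) \<longleftrightarrow> (\<forall>k\<ge>1. qcontractive (toeplitz k f))"
    unfolding qcontractive_toeplitz_iff contractive_fps_def
    by (metis order_refl sqsum_mono less_one not_le sqsum_nonneg sqsum_eq_0_iff not_less_zero)
  then show ?thesis
    by simp
qed

lemma right_indep_cols_pick_matrix_iff:
  assumes f: "contractive_fps f" and J: "J \<subseteq> {..<k}"
  shows "right_indep_cols (pick_matrix k f) J \<longleftrightarrow>
    (\<forall>c. sqsum k (fps_qcnj f * fps_flip k (\<Sum>j\<in>J. fps_X ^ j * fps_const (c j)))
          = sqsum k (\<Sum>j\<in>J. fps_X ^ j * fps_const (c j)) \<longrightarrow> (\<forall>j\<in>J. c j = 0))"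
proof -
  have fin: "finite J"
    using J finite_subset by blast
  have nth: "(\<Sum>j\<in>J. fps_X ^ j * fps_const (c j)) $ i = (if i \<in> J then c i else 0)" for c :: "nat \<Rightarrow> quat" and i
  proof -
    have "(\<Sum>j\<in>J. fps_X ^ j * fps_const (c j)) $ i = (\<Sum>j\<in>J. if i = j then c j else 0)"
      unfolding fps_sum_nth by (intro sum.cong) (auto simp: fps_X_power_mult_nth)
    then show ?thesis
      using fin by simp
  qed
  have "(\<Sum>j\<in>J. pick_matrix k f $$ (i, j) * c j)
      = pick_form k f (\<Sum>j\<in>J. fps_X ^ j * fps_const (c j)) $ i" if "i < k" for i c
  proof -
    have "(\<Sum>j\<in>J. pick_matrix k f $$ (i, j) * c j)
      = (\<Sum>j<k. pick_matrix k f $$ (i, j) * (\<Sum>j\<in>J. fps_X ^ j * fps_const (c j)) $ j)"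
      unfolding nth using J by (intro sum.mono_neutral_cong_left) auto
    then show ?thesis
      unfolding pick_matrix_mult[OF that] .
  qed
  then show ?thesis
    unfolding right_indep_cols_def pick_form_eq_0_iff[OF f, symmetric] by simp
qed

text \<open>The first \<open>min k n\<close> columns are independent by
  \<open>dual_blaschke_no_isometric\<close>; more than \<open>n\<close> columns are dependent by
  \<open>dual_blaschke_functionals\<close>.\<close>

lemma qrank_pick_matrix_blaschke:
  assumes "is_blaschke_product n f" and k: "k \<ge> 1"
  shows "qrank (pick_matrix k f) = min k n"
proof -
  define h where "h = fps_qcnj f"
  have h: "dual_blaschke n h"
    unfolding h_def by (rule dual_blaschke_fps_qcnj[OF assms(1)])
  have hc: "contractive_fps h" and fc: "contractive_fps f"
    using contractive_dual_blaschke[OF h] by (simp_all add: h_def)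
  define comb where "comb J c = (\<Sum>j\<in>J. fps_X ^ j * fps_const (c j))" for J and c :: "nat \<Rightarrow> quat"
  have indep: "right_indep_cols (pick_matrix k f) J \<longleftrightarrow>
    (\<forall>c. sqsum k (h * fps_flip k (comb J c)) = sqsum k (comb J c) \<longrightarrow> (\<forall>j\<in>J. c j = 0))"
    if "J \<subseteq> {..<k}" for J
    unfolding h_def comb_def by (rule right_indep_cols_pick_matrix_iff[OF fc that])
  define m where "m = min k n"
  have mk: "m \<le> k"
    by (simp add: m_def)
  show ?thesis
  proof (rule qrank_eqI[of "{..<m}"])
    show "right_indep_cols (pick_matrix k f) {..<m}"
      unfolding indep[OF lessThan_subset_iff[THEN iffD2, OF mk]]
    proof (intro allI impI)
      fix c
      define x where "x = comb {..<m} c"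
      have nth: "x $ i = (if i < m then c i else 0)" for i
      proof -
        have "x $ i = (\<Sum>j<m. if i = j then c j else 0)"
          unfolding x_def comb_def fps_sum_nth by (intro sum.cong) (auto simp: fps_X_power_mult_nth)
        then show ?thesis
          by simp
      qed
      have x: "deg_lt m x"
        by (simp add: deg_lt_def nth)
      \<comment> \<open>Reversing a vector supported in the first \<open>m\<close> places gives a
        multiple of z^(k-m). This power does not affect norms, so the order drops from
        \<open>k\<close> to \<open>m\<close>, which is at most \<open>n\<close>.\<close>
      have flip: "fps_flip k x = fps_X ^ (k - m) * fps_flip m x"
        using mk by (auto simp: fps_eq_iff fps_X_power_mult_nth nth intro: arg_cong[where f = c])
      assume "sqsum k (h * fps_flip k (comb {..<m} c)) = sqsum k (comb {..<m} c)"
      then have "sqsum k (h * fps_flip k x) = sqsum m x"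
        using sqsum_deg_lt[OF x mk] by (simp add: x_def)
      moreover have "h * fps_flip k x = fps_X ^ (k - m) * (h * fps_flip m x)"
        unfolding flip by (metis fps_mult_fps_X_power_commute mult.assoc)
      moreover have "sqsum k (fps_X ^ (k - m) * (h * fps_flip m x)) = sqsum m (h * fps_flip m x)"
        using sqsum_X_power_mult[of "k - m" m] mk by simp
      ultimately have "isometric_poly m h (fps_flip m x)"
        by (simp add: isometric_poly_def)
      then have "isometric_poly n h (fps_flip m x)"
        by (rule isometric_poly_mono[OF hc]) (simp add: m_def)
      then have "fps_flip m x = 0"
        using dual_blaschke_no_isometric[OF h] by (auto simp: has_isometric_def)
      then have "x = 0"
        using fps_flip_eq_0_iff[OF x] by simp
      then show "\<forall>j\<in>{..<m}. c j = 0"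
        using nth by (metis fps_zero_nth lessThan_iff)
    qed
  next
    fix J assume J: "J \<subseteq> {..<dim_col (pick_matrix k f)}" "right_indep_cols (pick_matrix k f) J"
    then have Jk: "J \<subseteq> {..<k}"
      by simp
    have fin: "finite J"
      using Jk finite_subset by blast
    have "card J \<le> n"
    proof (rule ccontr)
      assume "\<not> card J \<le> n"
      obtain Ls where Ls: "length Ls = n" "\<And>L. L \<in> set Ls \<Longrightarrow> right_linear L"
        "\<And>x. (\<forall>L\<in>set Ls. L x = 0) \<Longrightarrow> sqsum k (h * x) = sqsum k x"
        using dual_blaschke_functionals[OF h, of "k - 1"] k by auto
      \<comment> \<open>These are \<open>n\<close> homogeneous equations in more than
        \<open>n\<close> unknowns.\<close>
      obtain c where c: "\<exists>j\<in>J. c j \<noteq> 0"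
        "\<And>i. i < n \<Longrightarrow> (\<Sum>j\<in>J. (Ls ! i) (fps_flip k (fps_X ^ j)) * c j) = 0"
        using exists_nontrivial_right_solution[OF fin, of n "\<lambda>i j. (Ls ! i) (fps_flip k (fps_X ^ j))"]
          \<open>\<not> card J \<le> n\<close> by auto
      have flip: "fps_flip k (comb J c) = (\<Sum>j\<in>J. fps_flip k (fps_X ^ j) * fps_const (c j))"
        by (simp add: fps_eq_iff comb_def fps_sum_nth)
      have "L (fps_flip k (comb J c)) = 0" if L: "L \<in> set Ls" for L
      proof -
        obtain i where "i < n" "L = Ls ! i"
          using L Ls(1) by (auto simp: in_set_conv_nth)
        then show ?thesis
          unfolding flip right_linear_combination[OF Ls(2)[OF L] fin] using c(2) by simp
      qed
      then have "sqsum k (h * fps_flip k (comb J c)) = sqsum k (comb J c)"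
        using Ls(3) by (metis sqsum_flip)
      then show False
        using J(2) c(1) unfolding indep[OF Jk] by blast
    qed
    moreover have "card J \<le> k"
      using card_mono[OF _ Jk] by simp
    ultimately show "card J \<le> min k n"
      by simp
  qed (simp_all add: m_def)
qed

lemma has_isometric_if_qrank_less:
  assumes f: "contractive_fps f" and rank: "qrank (pick_matrix k f) < k"
  shows "has_isometric k (fps_qcnj f)"
proof -
  have "\<not> right_indep_cols (pick_matrix k f) {..<k}"
    using right_indep_cols_card_le_qrank[of "{..<k}" "pick_matrix k f"] rank by auto
  then obtain c where c: "\<exists>j<k. c j \<noteq> 0"
    and iso: "sqsum k (fps_qcnj f * fps_flip k (\<Sum>j<k. fps_X ^ j * fps_const (c j)))
      = sqsum k (\<Sum>j<k. fps_X ^ j * fps_const (c j))"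
    unfolding right_indep_cols_pick_matrix_iff[OF f order_refl] by blast
  define p where "p = fps_flip k (\<Sum>j<k. fps_X ^ j * fps_const (c j))"
  have "p \<noteq> 0"
  proof -
    obtain j where j: "j < k" "c j \<noteq> 0"
      using c by blast
    have "(\<Sum>j<k. fps_X ^ j * fps_const (c j)) $ j = (\<Sum>i<k. if j = i then c i else 0)"
      unfolding fps_sum_nth by (intro sum.cong) (auto simp: fps_X_power_mult_nth)
    then have "p $ (k - Suc j) \<noteq> 0"
      using j by (simp add: p_def)
    then show ?thesis
      by auto
  qed
  moreover have "isometric_poly k (fps_qcnj f) p"
    using iso by (simp add: isometric_poly_def p_def)
  ultimately show ?thesis
    unfolding has_isometric_def by blast
qed

theorem theorem5p3:
  fixes f :: "quat fps" and n :: nat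
  shows "is_blaschke_product n f \<longleftrightarrow>
    (\<forall>k \<ge> 1. qcontractive (toeplitz k f) \<and> qrank (pick_matrix k f) = min k n)"
proof
  assume b: "is_blaschke_product n f"
  then have "contractive_fps f"
    using contractive_dual_blaschke[OF dual_blaschke_fps_qcnj] by fastforce
  then show "\<forall>k \<ge> 1. qcontractive (toeplitz k f) \<and> qrank (pick_matrix k f) = min k n"
    using contractive_fps_iff_qcontractive qrank_pick_matrix_blaschke[OF b] by blast
next
  assume *: "\<forall>k \<ge> 1. qcontractive (toeplitz k f) \<and> qrank (pick_matrix k f) = min k n"
  then have f: "contractive_fps f"
    using contractive_fps_iff_qcontractive by blast
  \<comment> \<open>Order n + 1 is the first at which min k n falls below \<open>k\<close>.\<close>
  have "qrank (pick_matrix (Suc n) f) < Suc n"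
    using * by simp
  then have "has_isometric (Suc n) f"
    using has_isometric_if_qrank_less[OF f] has_isometric_qcnj_iff[OF f] by blast
  then obtain m where m: "is_blaschke_product m f"
    using is_blaschke_product_if_has_isometric[OF f] by blast
  \<comment> \<open>An order exceeding both degrees, so that the two expressions for the rank reduce
    to \<open>m\<close> and \<open>n\<close>.\<close>
  have "min (m + n + 1) m = min (m + n + 1) n"
    using qrank_pick_matrix_blaschke[OF m, of "m + n + 1"] * by simp
  then show "is_blaschke_product n f"
    using m by simp
qed

end
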